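(* There exist absolute positive constants $c$ and $K$ such that for all $n$ and all integers $\Delta$ with $0 \le \Delta \le c \log n$, $$\pi_{\Delta}(K_n) \ge \frac{n}{K}.$$
   Context: Let $G$ be a graph. A separating family of $G$ is a multiset $\mathcal{F}$ of total orders of $V(G)$ such that for any two disjoint edges $e,f$ of $G$ there is at least one element of $\mathcal{F}$ in which all vertices of one of the edges precede all vertices of the other (such an order separates $e$ and $f$). For disjoint edges $e,f$, $c_{\mathcal{F}}(\{e,f\})$ is the number of members of $\mathcal{F}$ (with multiplicity) separating them. For a nonnegative integer $\Delta$, a separating family $\mathcal{F}$ is $\Delta$-balanced if $|c_{\mathcal{F}}(\{e_1,f_1\})-c_{\mathcal{F}}(\{e_2,f_2\})| \le \Delta$ for any two pairs $\{e_1,f_1\}$, $\{e_2,f_2\}$ of disjoint edges. $\pi_\Delta(G)$ is the smallest size of a $\Delta$-balanced separating family of $G$. $K_n$ is the complete graph on $n$ vertices; $\log=\log_2$.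
   Formalization: The claim is proved for all n ≥ 4; for n = 1, 2, 3 it fails as written, since K_n has no two disjoint edges, so the empty family is 0-balanced and separating and π_0(K_n) = 0 < n/K, and for n = 0 log n is undefined. *)

theory Defs
  imports Complex_Main "HOL-Library.Multiset" "HOL-Combinatorics.Permutations"
begin

text \<open>A graph is a pair of a vertex set and a set of edges; edges are two-element vertex sets.\<close>

type_synonym 'a graph = "'a set \<times> 'a set set"

abbreviation verts :: "'a graph \<Rightarrow> 'a set" where
  "verts G \<equiv> fst G"

abbreviation edges :: "'a graph \<Rightarrow> 'a set set" where
  "edges G \<equiv> snd G"

definition finite_simple_graph :: "'a graph \<Rightarrow> bool" where
  "finite_simple_graph G \<longleftrightarrow>
     finite (verts G) \<and> (\<forall>e\<in>edges G. e \<subseteq> verts G \<and> card e = 2)"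

definition complete_graph :: "nat \<Rightarrow> nat graph" where
  "complete_graph n = ({..<n}, {e. e \<subseteq> {..<n} \<and> card e = 2})"

text \<open>Orders are reflexive relations; for disjoint \<open>e\<close> and \<open>f\<close> this is strict precedence.\<close>

definition separates :: "'a rel \<Rightarrow> 'a set \<Rightarrow> 'a set \<Rightarrow> bool" where
  "separates r e f \<longleftrightarrow>
     (\<forall>x\<in>e. \<forall>y\<in>f. (x, y) \<in> r) \<or> (\<forall>x\<in>e. \<forall>y\<in>f. (y, x) \<in> r)"

definition separating_family :: "'a graph \<Rightarrow> 'a rel multiset \<Rightarrow> bool" where
  "separating_family G F \<longleftrightarrow>
     (\<forall>r\<in>#F. linear_order_on (verts G) r) \<and>
     (\<forall>e\<in>edges G. \<forall>f\<in>edges G. e \<inter> f = {} \<longrightarrow> (\<exists>r\<in>#F. separates r e f))"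

definition sep_count :: "'a rel multiset \<Rightarrow> 'a set \<Rightarrow> 'a set \<Rightarrow> nat" where
  "sep_count F e f = size (filter_mset (\<lambda>r. separates r e f) F)"

definition balanced_separating_family :: "nat \<Rightarrow> 'a graph \<Rightarrow> 'a rel multiset \<Rightarrow> bool" where
  "balanced_separating_family \<Delta> G F \<longleftrightarrow>
     separating_family G F \<and>
     (\<forall>e1\<in>edges G. \<forall>f1\<in>edges G. \<forall>e2\<in>edges G. \<forall>f2\<in>edges G.
        e1 \<inter> f1 = {} \<longrightarrow> e2 \<inter> f2 = {} \<longrightarrow>
        \<bar>int (sep_count F e1 f1) - int (sep_count F e2 f2)\<bar> \<le> int \<Delta>)"

definition balanced_sep_dim :: "nat \<Rightarrow> 'a graph \<Rightarrow> nat" where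
  "balanced_sep_dim \<Delta> G = (LEAST k. \<exists>F. balanced_separating_family \<Delta> G F \<and> size F = k)"

text \<open>The minimum in \<^const>\<open>balanced_sep_dim\<close> is attained: by symmetry, the family of all
  linear orders on the vertex set is balanced.\<close>

lemma linear_order_on_image:
  assumes p: "p permutes V" and r: "linear_order_on V r"
  shows "linear_order_on V (map_prod p p ` r)"
proof -
  have ip: "p x = p y \<longleftrightarrow> x = y" for x y
    using permutes_inj[OF p] by (simp add: inj_eq)
  have iV: "p x \<in> V \<longleftrightarrow> x \<in> V" for x
    using permutes_in_image[OF p] .
  have ex: "\<exists>x\<in>V. y = p x" if "y \<in> V" for y
    using permutes_image[OF p] that by blast
  have r': "r \<subseteq> V \<times> V" "refl_on V r" "trans r" "antisym r" "total_on V r"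
    using r by (auto simp: order_on_defs)
  have "map_prod p p ` r \<subseteq> V \<times> V"
    using r'(1) iV by auto
  moreover have "refl_on V (map_prod p p ` r)"
  proof (rule refl_onI)
    fix y assume "y \<in> V"
    then obtain x where "x \<in> V" "y = p x" using ex by blast
    then show "(y, y) \<in> map_prod p p ` r"
      using r'(2) by (auto simp: refl_on_def)
  qed
  moreover have "trans (map_prod p p ` r)"
  proof (rule transI)
    fix x y z assume "(x, y) \<in> map_prod p p ` r" "(y, z) \<in> map_prod p p ` r"
    then obtain a b c where "(a, b) \<in> r" "(b, c) \<in> r" "x = p a" "z = p c"
      using ip by auto
    then show "(x, z) \<in> map_prod p p ` r"
      using transD[OF r'(3)] by force
  qed
  moreover have "antisym (map_prod p p ` r)"
    by (rule antisymI) (use ip antisymD[OF r'(4)] in auto)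
  moreover have "total_on V (map_prod p p ` r)"
  proof (rule total_onI)
    fix x y assume "x \<in> V" "y \<in> V" "x \<noteq> y"
    then obtain a b where "a \<in> V" "b \<in> V" "x = p a" "y = p b" "a \<noteq> b"
      using ex by metis
    then show "(x, y) \<in> map_prod p p ` r \<or> (y, x) \<in> map_prod p p ` r"
      using r'(5) by (force simp: total_on_def)
  qed
  ultimately show ?thesis
    by (simp add: order_on_defs)
qed

lemma exists_separating_order:
  assumes "e \<inter> f = {}"
  shows "\<exists>r. linear_order_on V r \<and> (\<forall>x\<in>e \<inter> V. \<forall>y\<in>f \<inter> V. (x, y) \<in> r)"
proof -
  obtain s where s: "linear_order_on V s"
    using well_order_on[of V] unfolding well_order_on_def by blast
  define k :: "'a \<Rightarrow> nat" where "k x = (if x \<in> e then 0 else 1)" for x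
  define r where "r = {(x, y). x \<in> V \<and> y \<in> V \<and> (k x < k y \<or> (k x = k y \<and> (x, y) \<in> s))}"
  have "trans r"
    using s unfolding r_def order_on_defs
    by (intro transI) (auto dest: transD)
  moreover have "antisym r" "total_on V r" "refl_on V r" "r \<subseteq> V \<times> V"
    using s unfolding r_def order_on_defs antisym_def total_on_def refl_on_def by auto
  moreover have "\<forall>x\<in>e \<inter> V. \<forall>y\<in>f \<inter> V. (x, y) \<in> r"
    using assms by (auto simp: r_def k_def)
  ultimately show ?thesis
    unfolding order_on_defs by blast
qed

lemma exists_permutation_pairs:
  assumes "finite V" "e1 \<subseteq> V" "f1 \<subseteq> V" "e2 \<subseteq> V" "f2 \<subseteq> V"
    and "card e1 = card e2" "card f1 = card f2" "e1 \<inter> f1 = {}" "e2 \<inter> f2 = {}"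
  shows "\<exists>p. p permutes V \<and> p ` e1 = e2 \<and> p ` f1 = f2"
proof -
  have fin: "finite e1" "finite f1" "finite e2" "finite f2"
    using assms finite_subset by blast+
  have c: "card (V - (e1 \<union> f1)) = card (V - (e2 \<union> f2))"
    using assms fin by (simp add: card_Diff_subset card_Un_disjoint)
  obtain g where g: "bij_betw g e1 e2"
    using fin assms finite_same_card_bij by blast
  obtain h where h: "bij_betw h f1 f2"
    using fin assms finite_same_card_bij by blast
  obtain i where i: "bij_betw i (V - (e1 \<union> f1)) (V - (e2 \<union> f2))"
    using c assms(1) finite_same_card_bij by (metis finite_Diff)
  define p where "p x = (if x \<in> e1 then g x else if x \<in> f1 then h x
    else if x \<in> V then i x else x)" for x
  have 1: "bij_betw p e1 e2"
    using g by (rule bij_betw_cong[THEN iffD1, rotated]) (simp add: p_def)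
  have 2: "bij_betw p f1 f2"
    using h assms by (intro bij_betw_cong[THEN iffD1, OF _ h]) (auto simp: p_def)
  have 3: "bij_betw p (V - (e1 \<union> f1)) (V - (e2 \<union> f2))"
    by (intro bij_betw_cong[THEN iffD1, OF _ i]) (auto simp: p_def)
  have "bij_betw p (e1 \<union> f1 \<union> (V - (e1 \<union> f1))) (e2 \<union> f2 \<union> (V - (e2 \<union> f2)))"
    using 1 2 3 assms by (intro bij_betw_combine) auto
  then have "bij_betw p V V"
    using assms by (simp add: Un_absorb1)
  then have "p permutes V"
    by (rule bij_imp_permutes) (use assms in \<open>auto simp: p_def\<close>)
  then show ?thesis
    using 1 2 by (auto simp: bij_betw_def)
qed

lemma balanced_separating_family_exists:
  assumes G: "finite_simple_graph G"
  shows "\<exists>F. balanced_separating_family \<Delta> G F"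
proof -
  define V where "V = verts G"
  define L where "L = {r. linear_order_on V r}"
  have V: "finite V" "\<And>e. e \<in> edges G \<Longrightarrow> e \<subseteq> V \<and> card e = 2"
    using G by (auto simp: finite_simple_graph_def V_def)
  have "L \<subseteq> Pow (V \<times> V)"
    by (auto simp: L_def order_on_defs)
  then have L: "finite L"
    using V(1) by (meson finite_Pow_iff finite_SigmaI finite_subset)
  have sep: "\<exists>r\<in>L. separates r e f" if "e \<in> edges G" "f \<in> edges G" "e \<inter> f = {}" for e f
    using exists_separating_order[OF that(3), of V] V(2)[OF that(1)] V(2)[OF that(2)]
    unfolding separates_def L_def by (metis inf.absorb_iff1 mem_Collect_eq)
  have cnt: "sep_count (mset_set L) e f = card {r \<in> L. separates r e f}" for e f
    using L by (simp add: sep_count_def)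
  have le: "card {r \<in> L. separates r e1 f1} \<le> card {r \<in> L. separates r e2 f2}"
    if e: "e1 \<in> edges G" "f1 \<in> edges G" "e2 \<in> edges G" "f2 \<in> edges G"
      "e1 \<inter> f1 = {}" "e2 \<inter> f2 = {}" for e1 f1 e2 f2
  proof -
    obtain p where p: "p permutes V" "p ` e1 = e2" "p ` f1 = f2"
      using exists_permutation_pairs[of V e1 f1 e2 f2] V e by metis
    have "inj (map_prod p p)"
      using permutes_inj[OF p(1)] by (simp add: prod.inj_map)
    then have "inj_on ((`) (map_prod p p)) {r \<in> L. separates r e1 f1}"
      by (meson inj_image_eq_iff inj_onI)
    moreover have "(`) (map_prod p p) ` {r \<in> L. separates r e1 f1} \<subseteq> {r \<in> L. separates r e2 f2}"
      using linear_order_on_image[OF p(1)] unfolding L_def separates_def p(2,3)[symmetric] by auto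
    ultimately show ?thesis
      using L by (intro card_inj_on_le) auto
  qed
  have "balanced_separating_family \<Delta> G (mset_set L)"
    unfolding balanced_separating_family_def separating_family_def cnt
  proof (intro conjI ballI impI)
    fix r assume "r \<in># mset_set L"
    then show "linear_order_on (verts G) r"
      using L by (simp add: L_def V_def)
  next
    fix e f assume "e \<in> edges G" "f \<in> edges G" "e \<inter> f = {}"
    then show "\<exists>r\<in>#mset_set L. separates r e f"
      using sep L by simp
  next
    fix e1 f1 e2 f2
    assume "e1 \<in> edges G" "f1 \<in> edges G" "e2 \<in> edges G" "f2 \<in> edges G"
      "e1 \<inter> f1 = {}" "e2 \<inter> f2 = {}"
    then have "card {r \<in> L. separates r e1 f1} = card {r \<in> L. separates r e2 f2}"
      by (intro le_antisym le)
    then show "\<bar>int (card {r \<in> L. separates r e1 f1}) -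
        int (card {r \<in> L. separates r e2 f2})\<bar> \<le> int \<Delta>"
      by simp
  qed
  then show ?thesis ..
qed

lemma finite_simple_graph_complete_graph: "finite_simple_graph (complete_graph n)"
  by (simp add: finite_simple_graph_def complete_graph_def)

text \<open>Below four vertices there are no disjoint edges and the empty family is separating.\<close>

lemma balanced_sep_dim_complete_graph_small:
  assumes "n < 4"
  shows "balanced_sep_dim \<Delta> (complete_graph n) = 0"
proof -
  have "e \<inter> f \<noteq> {}" if e: "e \<in> edges (complete_graph n)" "f \<in> edges (complete_graph n)" for e f
  proof
    assume "e \<inter> f = {}"
    moreover have "finite e" "finite f" "card e = 2" "card f = 2" "e \<union> f \<subseteq> {..<n}"
      using e by (auto simp: complete_graph_def intro: finite_subset)
    ultimately have "4 \<le> card {..<n}"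
      using card_mono[of "{..<n}" "e \<union> f"] by (simp add: card_Un_disjoint)
    then show False using assms by simp
  qed
  then have "balanced_separating_family \<Delta> (complete_graph n) {#}"
    by (auto simp: balanced_separating_family_def separating_family_def)
  then show ?thesis
    unfolding balanced_sep_dim_def by (intro Least_eq_0) auto
qed

end

theory Submission
  imports Defs "HOL-Real_Asymp.Real_Asymp"
begin

text \<open>Every order separates exactly one of the three pairings of four vertices, so in a balanced
  family of \<open>k\<close> orders each count is \<open>k/3\<close> up to \<open>\<Delta>\<close>. For an order \<open>i\<close> let \<open>X\<^sub>i(a,b)\<close> be the
  probability that \<open>{a,b}\<close> is separated from a random disjoint pair, minus \<open>1/3\<close>, with zero
  diagonal. Then \<open>|\<Sum>\<^sub>i X\<^sub>i(a,b)| \<le> \<Delta>\<close>. Up to a shift and a bounded diagonal, \<open>X\<^sub>i\<close> is a Gram matrix with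
  vanishing row sums, so \<open>X\<^sub>i + 3 I\<close> is positive semidefinite. Hence \<open>\<langle>X\<^sub>i, X\<^sub>j\<rangle> \<ge> - O(n)\<close> while
  \<open>\<langle>X\<^sub>i, X\<^sub>i\<rangle>\<close> has order \<open>n\<^sup>2\<close>, and the second moment of \<open>\<Sum>\<^sub>i X\<^sub>i\<close> gives \<open>k = O(\<Delta>\<^sup>2)\<close> unless \<open>k\<close> is linear
  in \<open>n\<close>.

  It remains to exclude \<open>k = O(log\<^sup>2 n)\<close>. Fix \<open>T\<close> orders with \<open>T\<close> a small multiple of \<open>log n\<close>. By pigeonhole
  at least \<open>\<surd>n\<close> vertices are pairwise close in all of them, so \<open>X\<^sub>i \<ge> 1/20\<close> on pairs of these vertices;
  by semidefiniteness the other orders lose only \<open>O(k/\<surd>n)\<close> on average, and \<open>\<Delta> \<ge> T/20 - 1\<close>. If there are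
  fewer than \<open>T\<close> orders, repeated halving yields two disjoint pairs that no order separates.\<close>

text \<open>The number of ordered pairs of distinct ranks below \<open>n\<close> lying both below \<open>min p q\<close> or both above
  \<open>max p q\<close>; \<open>t\<close> is the rank of the pair that is closer to \<open>p\<close> and \<open>q\<close>.\<close>

definition sep_kernel :: "nat \<Rightarrow> nat \<Rightarrow> nat \<Rightarrow> real" where
  "sep_kernel n p q = (\<Sum>t<n. 2 * real t * (of_bool (t < p) * of_bool (t < q)) +
     2 * (real n - 1 - real t) * (of_bool (p < t) * of_bool (q < t)))"

text \<open>For \<open>p \<noteq> q\<close>: the probability that the pair of ranks is separated from a random disjoint pair,
  minus its average \<open>1/3\<close>.\<close>

definition dev :: "nat \<Rightarrow> nat \<Rightarrow> nat \<Rightarrow> real" where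
  "dev n p q = (if p = q then 0 else sep_kernel n p q / ((real n - 2) * (real n - 3)) - 1/3)"

section \<open>Closed form and row sums of the separation kernel\<close>

lemma sep_kernel_commute: "sep_kernel n p q = sep_kernel n q p"
  by (simp add: sep_kernel_def mult.commute)

lemma dev_commute: "dev n p q = dev n q p"
  by (simp add: dev_def sep_kernel_commute)

lemma sum_lessThan_linear:
  "(\<Sum>t<m. 2 * (c - real t)) = 2 * c * real m - real m * (real m - 1)"
  by (induction m) (simp_all add: algebra_simps)

lemma sum_greaterThanLessThan_diff:
  fixes f :: "nat \<Rightarrow> real"
  assumes "q < n"
  shows "(\<Sum>t\<in>{q<..<n}. f t) = (\<Sum>t<n. f t) - (\<Sum>t<Suc q. f t)"
proof -
  have Un: "{..<n} = {..<Suc q} \<union> {q<..<n}" using assms by auto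
  have "(\<Sum>t<n. f t) = (\<Sum>t<Suc q. f t) + (\<Sum>t\<in>{q<..<n}. f t)"
    unfolding Un by (rule sum.union_disjoint) auto
  then show ?thesis by simp
qed

lemma sep_kernel_eq:
  assumes "p \<le> q" "q < n"
  shows "sep_kernel n p q = real p * (real p - 1) + (real n - 1 - real q) * (real n - 2 - real q)"
proof -
  have "(\<Sum>t<n. 2 * real t * (of_bool (t < p) * of_bool (t < q))) = (\<Sum>t<p. 2 * real t)"
    using assms by (intro sum.mono_neutral_cong_right) auto
  also have "\<dots> = real p * (real p - 1)"
    by (induction p) (simp_all add: algebra_simps)
  finally have 1: "(\<Sum>t<n. 2 * real t * (of_bool (t < p) * of_bool (t < q))) = real p * (real p - 1)" .
  have "(\<Sum>t<n. 2 * (real n - 1 - real t) * (of_bool (p < t) * of_bool (q < t))) =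
      (\<Sum>t\<in>{q<..<n}. 2 * (real n - 1 - real t))"
    using assms by (intro sum.mono_neutral_cong_right) auto
  also have "\<dots> = (real n - 1 - real q) * (real n - 2 - real q)"
    unfolding sum_greaterThanLessThan_diff[OF assms(2)] sum_lessThan_linear
    by (simp add: algebra_simps)
  finally show ?thesis
    unfolding sep_kernel_def sum.distrib 1 by simp
qed

text \<open>By the closed form, each entry is a term depending on \<open>q\<close> plus a constant:
  \<open>q * (q - 1)\<close> for \<open>q < p\<close>, and its mirror image for
  \<open>q > p\<close>. Summing gives cubic polynomials whose total no longer depends on
  \<open>p\<close>, so \<open>1/3\<close> is the mean of every single row, not just the overall
  mean.\<close>

lemma sum_sep_kernel_row:
  assumes "p < n"
  shows "3 * (\<Sum>q\<in>{..<n} - {p}. sep_kernel n p q) = (real n - 1) * ((real n - 2) * (real n - 3))"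
proof -
  have low: "3 * (\<Sum>q<m. real q * (real q - 1)) = real m * (real m - 1) * (real m - 2)" for m
    by (induction m) (simp_all add: algebra_simps)
  \<comment> \<open>Reversing the ranks turns the part above \<open>p\<close> into an initial
    segment, so the sum \<open>low\<close> evaluates both sides.\<close>
  have "bij_betw (\<lambda>q. n - 1 - q) {p<..<n} {..<n - 1 - p}"
    by (rule bij_betw_byWitness[where f' = "\<lambda>q. n - 1 - q"]) (use assms in auto)
  from sum.reindex_bij_betw[OF this, of "\<lambda>q. real q * (real q - 1)"]
  have "(\<Sum>q<n - 1 - p. real q * (real q - 1)) =
      (\<Sum>q\<in>{p<..<n}. (real n - 1 - real q) * (real n - 2 - real q))"
    by (subst (asm) eq_commute) (simp add: of_nat_diff diff_diff_eq)
  then have high: "3 * (\<Sum>q\<in>{p<..<n}. (real n - 1 - real q) * (real n - 2 - real q)) =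
      (real n - 1 - real p) * (real n - 2 - real p) * (real n - 3 - real p)"
    using low[of "n - 1 - p"] assms by (simp add: of_nat_diff algebra_simps)
  have Un: "{..<n} - {p} = {..<p} \<union> {p<..<n}" using assms by auto
  have split: "(\<Sum>q\<in>{..<n} - {p}. sep_kernel n p q) = (\<Sum>q<p. sep_kernel n p q) + (\<Sum>q\<in>{p<..<n}. sep_kernel n p q)"
    unfolding Un by (rule sum.union_disjoint) auto
  have "(\<Sum>q<p. sep_kernel n p q) =
      (\<Sum>q<p. real q * (real q - 1) + (real n - 1 - real p) * (real n - 2 - real p))"
    using assms by (intro sum.cong refl) (subst sep_kernel_commute, simp add: sep_kernel_eq)
  then have 1: "(\<Sum>q<p. sep_kernel n p q) = (\<Sum>q<p. real q * (real q - 1)) +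
      real p * ((real n - 1 - real p) * (real n - 2 - real p))"
    by (simp add: sum.distrib)
  have "(\<Sum>q\<in>{p<..<n}. sep_kernel n p q) =
      (\<Sum>q\<in>{p<..<n}. (real n - 1 - real q) * (real n - 2 - real q) + real p * (real p - 1))"
    by (intro sum.cong refl) (simp add: sep_kernel_eq)
  then have 2: "(\<Sum>q\<in>{p<..<n}. sep_kernel n p q) =
      (\<Sum>q\<in>{p<..<n}. (real n - 1 - real q) * (real n - 2 - real q)) +
      (real n - 1 - real p) * (real p * (real p - 1))"
    using assms by (simp add: sum.distrib of_nat_diff)
  show ?thesis
    unfolding split 1 2 distrib_left low high by (simp add: algebra_simps)
qed

lemma sum_dev_row:
  assumes "p < n" "4 \<le> n"
  shows "(\<Sum>q<n. dev n p q) = 0"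
proof -
  have "(\<Sum>q<n. dev n p q) = (\<Sum>q\<in>{..<n} - {p}. sep_kernel n p q / ((real n - 2) * (real n - 3)) - 1/3)"
    using assms by (intro sum.mono_neutral_cong_right) (auto simp: dev_def)
  also have "\<dots> = (\<Sum>q\<in>{..<n} - {p}. sep_kernel n p q) / ((real n - 2) * (real n - 3)) - (real n - 1) / 3"
    using assms by (simp add: sum_subtractf sum_divide_distrib of_nat_diff)
  also have "(\<Sum>q\<in>{..<n} - {p}. sep_kernel n p q) = (real n - 1) / 3 * ((real n - 2) * (real n - 3))"
    using sum_sep_kernel_row[OF assms(1)] by simp
  also have "\<dots> / ((real n - 2) * (real n - 3)) = (real n - 1) / 3"
    using assms by (intro nonzero_mult_div_cancel_right) auto
  finally show ?thesis by simp
qed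

section \<open>Positive semidefiniteness up to a bounded diagonal\<close>

lemma sep_kernel_diag_le:
  assumes "p < n"
  shows "sep_kernel n p p \<le> (real n - 1) * (real n - 2)"
proof -
  \<comment> \<open>The closed form at \<open>p = q\<close> falls short of the bound by exactly
    twice this product.\<close>
  have "0 \<le> real p * (real n - 1 - real p)"
    using assms by (intro mult_nonneg_nonneg) auto
  then show ?thesis
    using assms by (simp add: sep_kernel_eq algebra_simps)
qed

text \<open>\<^term>\<open>sep_kernel n\<close> is a Gram kernel: the features are the half-lines of ranks above and below
  each \<open>t\<close>.\<close>

lemma sep_kernel_quadratic_form:
  "(\<Sum>a\<in>V. \<Sum>b\<in>V. M a b * sep_kernel n (\<rho> a) (\<rho> b)) =
    (\<Sum>t<n. 2 * real t * (\<Sum>a\<in>V. \<Sum>b\<in>V. of_bool (t < \<rho> a) * of_bool (t < \<rho> b) * M a b) +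
      2 * (real n - 1 - real t) * (\<Sum>a\<in>V. \<Sum>b\<in>V. of_bool (\<rho> a < t) * of_bool (\<rho> b < t) * M a b))"
proof -
  have "(\<Sum>a\<in>V. \<Sum>b\<in>V. M a b * sep_kernel n (\<rho> a) (\<rho> b)) =
    (\<Sum>a\<in>V. \<Sum>b\<in>V. \<Sum>t<n. 2 * real t * (of_bool (t < \<rho> a) * of_bool (t < \<rho> b) * M a b) +
      2 * (real n - 1 - real t) * (of_bool (\<rho> a < t) * of_bool (\<rho> b < t) * M a b))"
    by (intro sum.cong refl) (simp add: sep_kernel_def sum_distrib_left algebra_simps)
  also have "\<dots> = (\<Sum>t<n. \<Sum>a\<in>V. \<Sum>b\<in>V. 2 * real t * (of_bool (t < \<rho> a) * of_bool (t < \<rho> b) * M a b) +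
      2 * (real n - 1 - real t) * (of_bool (\<rho> a < t) * of_bool (\<rho> b < t) * M a b))"
    by (subst (2) sum.swap, subst sum.swap) simp
  finally show ?thesis
    by (simp add: sum.distrib sum_distrib_left)
qed

text \<open>Every inner double sum of the Gram decomposition is the form of \<open>M\<close> at an
  indicator vector, and the weights \<open>2 * t\<close> and \<open>2 * (n - 1 - t)\<close> are
  nonnegative. This pairs two semidefinite forms without any spectral theory.\<close>

lemma sep_kernel_quadratic_form_nonneg:
  assumes "\<And>z. 0 \<le> (\<Sum>a\<in>V. \<Sum>b\<in>V. z a * z b * M a b)"
  shows "0 \<le> (\<Sum>a\<in>V. \<Sum>b\<in>V. M a b * sep_kernel n (\<rho> a) (\<rho> b))"
  unfolding sep_kernel_quadratic_form
  by (intro sum_nonneg add_nonneg_nonneg mult_nonneg_nonneg assms) auto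

text \<open>The rank-one case \<open>M a b = w a * w b\<close>, whose form at \<open>z\<close> is a
  square.\<close>

lemma sep_kernel_positive_semidefinite:
  "0 \<le> (\<Sum>a\<in>V. \<Sum>b\<in>V. w a * w b * sep_kernel n (\<rho> a) (\<rho> b))"
proof (rule sep_kernel_quadratic_form_nonneg)
  fix z :: "'a \<Rightarrow> real"
  have "(\<Sum>a\<in>V. \<Sum>b\<in>V. z a * z b * (w a * w b)) = (\<Sum>a\<in>V. z a * w a)\<^sup>2"
    by (simp add: power2_eq_square sum_product algebra_simps)
  then show "0 \<le> (\<Sum>a\<in>V. \<Sum>b\<in>V. z a * z b * (w a * w b))" by simp
qed

lemma sum_dev_rank_row:
  assumes \<rho>: "bij_betw \<rho> {..<n} {..<n}" and "4 \<le> n" "a < n"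
  shows "(\<Sum>b<n. dev n (\<rho> a) (\<rho> b)) = 0"
proof -
  have "\<rho> a < n" using bij_betwE[OF \<rho>] assms(3) by auto
  then show ?thesis
    using sum.reindex_bij_betw[OF \<rho>, of "dev n (\<rho> a)"] sum_dev_row assms(2) by simp
qed

text \<open>The kernel does not vanish on the diagonal but \<open>dev\<close> does. Isolating this
  as a correction term lets the Gram structure be used on the full matrix.\<close>

lemma dev_rank_eq:
  assumes \<rho>: "bij_betw \<rho> {..<n} {..<n}" and "a < n" "b < n"
  shows "dev n (\<rho> a) (\<rho> b) = sep_kernel n (\<rho> a) (\<rho> b) / ((real n - 2) * (real n - 3)) - 1/3
    - (if a = b then sep_kernel n (\<rho> a) (\<rho> a) / ((real n - 2) * (real n - 3)) - 1/3 else 0)"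
  using bij_betw_imp_inj_on[OF \<rho>] assms(2,3) by (auto simp: dev_def inj_on_def)

lemma sep_kernel_diag_ratio_le:
  assumes "p < n" "4 \<le> n"
  shows "sep_kernel n p p / ((real n - 2) * (real n - 3)) \<le> 3"
proof -
  \<comment> \<open>The factor \<open>3\<close> is the value of \<open>(n - 1) / (n - 3)\<close> at
    \<open>n = 4\<close>, where this ratio is largest.\<close>
  have "(real n - 1) * (real n - 2) \<le> 3 * (real n - 3) * (real n - 2)"
    using assms by (intro mult_right_mono) auto
  then have "sep_kernel n p p \<le> 3 * ((real n - 2) * (real n - 3))"
    using sep_kernel_diag_le[OF assms(1)] by (simp add: algebra_simps)
  then show ?thesis
    using assms(2) by (subst divide_le_eq) auto
qed

lemma dev_form_eq:
  assumes \<rho>: "bij_betw \<rho> {..<n} {..<n}"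
  shows "(\<Sum>a<n. \<Sum>b<n. M a b * dev n (\<rho> a) (\<rho> b)) =
     (\<Sum>a<n. \<Sum>b<n. M a b * sep_kernel n (\<rho> a) (\<rho> b)) / ((real n - 2) * (real n - 3)) 
      - (\<Sum>a<n. \<Sum>b<n. M a b) / 3
      - (\<Sum>a<n. M a a * (sep_kernel n (\<rho> a) (\<rho> a) / ((real n - 2) * (real n - 3)) - 1/3))"
proof -
  have "(\<Sum>a<n. \<Sum>b<n. M a b * dev n (\<rho> a) (\<rho> b)) =
    (\<Sum>a<n. \<Sum>b<n. M a b * sep_kernel n (\<rho> a) (\<rho> b) / ((real n - 2) * (real n - 3)) - M a b / 3
     - (if a = b then M a b * (sep_kernel n (\<rho> a) (\<rho> a) / ((real n - 2) * (real n - 3)) - 1/3) else 0))"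
    by (intro sum.cong refl) (auto simp: dev_rank_eq[OF \<rho>] algebra_simps)
  then show ?thesis
    by (simp add: sum_subtractf sum_divide_distrib)
qed

text \<open>The constant vector lies in the kernel of \<^term>\<open>dev n\<close>, so the form only sees the
  centred part of \<open>z\<close>, on which the shift by \<open>1/3\<close> vanishes.\<close>

lemma dev_form_ge:
  assumes \<rho>: "bij_betw \<rho> {..<n} {..<n}" and n: "4 \<le> n"
  shows "(\<Sum>a<n. \<Sum>b<n. z a * z b * dev n (\<rho> a) (\<rho> b)) \<ge> - 3 * (\<Sum>a<n. (z a)\<^sup>2)"
proof -
  define m where "m = (\<Sum>a<n. z a) / real n"
  define w where "w a = z a - m" for a
  have w0: "(\<Sum>a<n. w a) = 0"
    using n by (simp add: w_def sum_subtractf m_def)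
  have row: "(\<Sum>b<n. dev n (\<rho> a) (\<rho> b)) = 0" if "a < n" for a
    by (rule sum_dev_rank_row[OF \<rho> n that])
  have col: "(\<Sum>a<n. dev n (\<rho> a) (\<rho> b)) = 0" if "b < n" for b
    using row[OF that] by (simp add: dev_commute)
  have "(\<Sum>a<n. \<Sum>b<n. z a * z b * dev n (\<rho> a) (\<rho> b)) =
      (\<Sum>a<n. \<Sum>b<n. w a * w b * dev n (\<rho> a) (\<rho> b)) +
      (\<Sum>a<n. \<Sum>b<n. m * z a * dev n (\<rho> a) (\<rho> b)) +
      (\<Sum>a<n. \<Sum>b<n. m * w b * dev n (\<rho> a) (\<rho> b))"
    unfolding w_def by (simp add: sum.distrib[symmetric] algebra_simps)
  also have "(\<Sum>a<n. \<Sum>b<n. m * z a * dev n (\<rho> a) (\<rho> b)) = 0"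
    by (simp add: sum_distrib_left[symmetric] row)
  also have "(\<Sum>a<n. \<Sum>b<n. m * w b * dev n (\<rho> a) (\<rho> b)) = 0"
    by (subst sum.swap) (simp add: sum_distrib_left[symmetric] col)
  also have "(\<Sum>a<n. \<Sum>b<n. w a * w b * dev n (\<rho> a) (\<rho> b)) =
      (\<Sum>a<n. \<Sum>b<n. w a * w b * sep_kernel n (\<rho> a) (\<rho> b)) / ((real n - 2) * (real n - 3))
      - (\<Sum>a<n. \<Sum>b<n. w a * w b) / 3
      - (\<Sum>a<n. w a * w a * (sep_kernel n (\<rho> a) (\<rho> a) / ((real n - 2) * (real n - 3)) - 1/3))"
    by (rule dev_form_eq[OF \<rho>])
  also have "(\<Sum>a<n. \<Sum>b<n. w a * w b) = 0"
    using w0 by (simp add: sum_distrib_left[symmetric])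
  finally have eq: "(\<Sum>a<n. \<Sum>b<n. z a * z b * dev n (\<rho> a) (\<rho> b)) =
     (\<Sum>a<n. \<Sum>b<n. w a * w b * sep_kernel n (\<rho> a) (\<rho> b)) / ((real n - 2) * (real n - 3))
      - (\<Sum>a<n. w a * w a * (sep_kernel n (\<rho> a) (\<rho> a) / ((real n - 2) * (real n - 3)) - 1/3))"
    by simp
  have 1: "0 \<le> (\<Sum>a<n. \<Sum>b<n. w a * w b * sep_kernel n (\<rho> a) (\<rho> b)) / ((real n - 2) * (real n - 3))"
    using n by (intro divide_nonneg_nonneg sep_kernel_positive_semidefinite) auto
  have "(\<Sum>a<n. w a * w a * (sep_kernel n (\<rho> a) (\<rho> a) / ((real n - 2) * (real n - 3)) - 1/3)) 
      \<le> (\<Sum>a<n. w a * w a * 3)"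
  proof (intro sum_mono mult_left_mono)
    fix a assume "a \<in> {..<n}"
    then have "\<rho> a < n" using bij_betwE[OF \<rho>] by auto
    from sep_kernel_diag_ratio_le[OF this n]
    show "sep_kernel n (\<rho> a) (\<rho> a) / ((real n - 2) * (real n - 3)) - 1/3 \<le> 3" by simp
  qed auto
  also have "\<dots> = 3 * (\<Sum>a<n. (w a)\<^sup>2)"
    by (simp add: sum_distrib_left power2_eq_square mult.commute)
  \<comment> \<open>The constant part of \<open>z\<close> is orthogonal to \<open>w\<close>, so
    centring cannot increase the sum of squares.\<close>
  also have "(\<Sum>a<n. (w a)\<^sup>2) \<le> (\<Sum>a<n. (z a)\<^sup>2)"
  proof -
    have "(\<Sum>a<n. (z a)\<^sup>2) = (\<Sum>a<n. (w a)\<^sup>2 + 2 * m * w a + m\<^sup>2)"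
      by (simp add: w_def power2_eq_square algebra_simps)
    also have "\<dots> = (\<Sum>a<n. (w a)\<^sup>2) + real n * m\<^sup>2"
      using w0 by (simp add: sum.distrib sum_distrib_left[symmetric])
    finally show ?thesis by simp
  qed
  finally show ?thesis using eq 1 by linarith
qed

text \<open>Adding \<open>3\<close> on the diagonal makes the matrix of \<open>\<sigma>\<close>
  positive semidefinite, and leaves the inner product unchanged since the matrix of
  \<open>\<rho>\<close> has zero diagonal. Its pairing with the kernel of \<open>\<rho>\<close> is
  then nonnegative. The shift by \<open>1/3\<close> costs \<open>n\<close>, because the entries of
  \<open>M\<close> sum to \<open>3 * n\<close>, and the diagonal correction costs at most
  \<open>9 * n\<close>.\<close>

lemma dev_inner_ge:
  assumes \<rho>: "bij_betw \<rho> {..<n} {..<n}" and \<sigma>: "bij_betw \<sigma> {..<n} {..<n}" and n: "4 \<le> n"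
  shows "(\<Sum>a<n. \<Sum>b<n. dev n (\<sigma> a) (\<sigma> b) * dev n (\<rho> a) (\<rho> b)) \<ge> - 10 * real n"
proof -
  define M where "M a b = dev n (\<sigma> a) (\<sigma> b) + 3 * of_bool (a = b)" for a b
  have dg: "(\<Sum>a<n. \<Sum>b<n. f a b * of_bool (a = b)) = (\<Sum>a<n. f a a)" for f :: "nat \<Rightarrow> nat \<Rightarrow> real"
    by (intro sum.cong refl) (simp add: of_bool_def if_distrib cong: if_cong)
  have "(\<Sum>a<n. \<Sum>b<n. z a * z b * M a b) =
      (\<Sum>a<n. \<Sum>b<n. z a * z b * dev n (\<sigma> a) (\<sigma> b)) +
      3 * (\<Sum>a<n. \<Sum>b<n. z a * z b * of_bool (a = b))" for z
    by (simp add: M_def sum.distrib sum_distrib_left algebra_simps)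
  then have psd: "0 \<le> (\<Sum>a<n. \<Sum>b<n. z a * z b * M a b)" for z
    using dev_form_ge[OF \<sigma> n, of z] by (simp only: dg) (simp add: power2_eq_square)
  have "(\<Sum>a<n. \<Sum>b<n. M a b * dev n (\<rho> a) (\<rho> b)) =
      (\<Sum>a<n. \<Sum>b<n. dev n (\<sigma> a) (\<sigma> b) * dev n (\<rho> a) (\<rho> b)) + 
      (\<Sum>a<n. \<Sum>b<n. 3 * dev n (\<rho> a) (\<rho> b) * of_bool (a = b))"
    by (simp add: M_def sum.distrib[symmetric] algebra_simps)
  also have "(\<Sum>a<n. \<Sum>b<n. 3 * dev n (\<rho> a) (\<rho> b) * of_bool (a = b)) = 0"
    unfolding dg by (simp add: dev_def)
  finally have eq: "(\<Sum>a<n. \<Sum>b<n. dev n (\<sigma> a) (\<sigma> b) * dev n (\<rho> a) (\<rho> b)) =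
     (\<Sum>a<n. \<Sum>b<n. M a b * sep_kernel n (\<rho> a) (\<rho> b)) / ((real n - 2) * (real n - 3)) 
      - (\<Sum>a<n. \<Sum>b<n. M a b) / 3
      - (\<Sum>a<n. M a a * (sep_kernel n (\<rho> a) (\<rho> a) / ((real n - 2) * (real n - 3)) - 1/3))"
    using dev_form_eq[OF \<rho>, of M] by simp
  have 1: "0 \<le> (\<Sum>a<n. \<Sum>b<n. M a b * sep_kernel n (\<rho> a) (\<rho> b)) / ((real n - 2) * (real n - 3))"
    using n by (intro divide_nonneg_nonneg sep_kernel_quadratic_form_nonneg psd) auto
  have "(\<Sum>a<n. \<Sum>b<n. M a b) = (\<Sum>a<n. \<Sum>b<n. dev n (\<sigma> a) (\<sigma> b)) + (\<Sum>a<n. \<Sum>b<n. 3 * of_bool (a = b))"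
    by (simp add: M_def sum.distrib)
  also have "\<dots> = 3 * real n"
    unfolding dg using sum_dev_rank_row[OF \<sigma> n] by simp
  finally have 2: "(\<Sum>a<n. \<Sum>b<n. M a b) = 3 * real n" .
  have "(\<Sum>a<n. M a a * (sep_kernel n (\<rho> a) (\<rho> a) / ((real n - 2) * (real n - 3)) - 1/3)) \<le> (\<Sum>a<n. 3 * 3)"
  proof (intro sum_mono)
    fix a assume "a \<in> {..<n}"
    then have "\<rho> a < n" using bij_betwE[OF \<rho>] by auto
    from sep_kernel_diag_ratio_le[OF this n]
    show "M a a * (sep_kernel n (\<rho> a) (\<rho> a) / ((real n - 2) * (real n - 3)) - 1/3) \<le> 3 * 3"
      by (simp add: M_def dev_def)
  qed
  then show ?thesis using eq 1 2 by simp
qed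

section \<open>Positive deviation at close ranks\<close>

text \<open>Here \<open>x\<close> and \<open>y\<close> stand for the numbers of ranks below and
  above a close pair. By convexity the even split \<open>x = y\<close> is the worst case; it gives
  about \<open>81/200 * N^2\<close>, which still exceeds \<open>23/60 * N^2\<close>.\<close>

lemma quadratic_bound_of_sum:
  fixes x y N :: real
  assumes "9/10 * N - 1 \<le> x + y" "400 \<le> N"
  shows "23/60 * ((N - 2) * (N - 3)) \<le> x * (x - 1) + y * (y - 1)"
proof -
  have "2 * (x * (x - 1) + y * (y - 1)) = (x + y) * (x + y - 2) + (x - y)\<^sup>2"
    by (simp add: power2_eq_square algebra_simps)
  then have 1: "(x + y) * (x + y - 2) \<le> 2 * (x * (x - 1) + y * (y - 1))"
    by simp
  have 2: "(9/10 * N - 1) * (9/10 * N - 3) \<le> (x + y) * (x + y - 2)"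
    using assms by (intro mult_mono) auto
  have "0 \<le> N * (13/300 * N + 7/30) - 8/5"
  proof -
    have "400 * 1 \<le> N * (13/300 * N + 7/30)" using assms by (intro mult_mono) auto
    then show ?thesis by simp
  qed
  also have "\<dots> = (9/10 * N - 1) * (9/10 * N - 3) - 2 * (23/60 * ((N - 2) * (N - 3)))"
    by (simp add: field_simps)
  finally show ?thesis using order_trans[OF 2 1] by simp
qed

text \<open>At most a tenth of the ranks separates \<open>p\<close> from \<open>q\<close>, so nearly
  all others lie outside the interval between them. The gain is
  \<open>23/60 - 1/3 = 1/20\<close>.\<close>

lemma dev_ge_of_close:
  assumes "p \<noteq> q" "p < n" "q < n" and n: "400 \<le> n"
    and pq: "\<bar>real p - real q\<bar> \<le> real n / 10"
  shows "1/20 \<le> dev n p q"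
  using assms(1,2,3,5)
proof (induction p q rule: linorder_wlog)
  case (sym p q)
  then show ?case by (simp add: dev_commute abs_minus_commute)
next
  case (le p q)
  have "23/60 * ((real n - 2) * (real n - 3)) \<le>
      real p * (real p - 1) + (real n - 1 - real q) * (real n - 1 - real q - 1)"
    using le n by (intro quadratic_bound_of_sum) auto
  also have "\<dots> = sep_kernel n p q" using le by (simp add: sep_kernel_eq)
  finally have "sep_kernel n p q / ((real n - 2) * (real n - 3)) \<ge> 23/60"
    using n by (subst le_divide_eq) auto
  moreover have "dev n p q = sep_kernel n p q / ((real n - 2) * (real n - 3)) - 1/3"
    using le by (simp add: dev_def)
  ultimately show ?case by linarith
qed

lemma card_rank_lessThan:
  assumes \<rho>: "bij_betw \<rho> {..<n} {..<n}" and "m \<le> n"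
  shows "card {b. b < n \<and> \<rho> b < m} = m"
proof -
  have "\<rho> ` {b. b < n \<and> \<rho> b < m} = {..<m}"
    using bij_betw_imp_surj_on[OF \<rho>] assms(2) by (auto simp: set_eq_iff image_iff) (metis lessThan_iff order_less_le_trans)
  moreover have "inj_on \<rho> {b. b < n \<and> \<rho> b < m}"
    using bij_betw_imp_inj_on[OF \<rho>] by (rule inj_on_subset) auto
  ultimately show ?thesis by (metis card_image card_lessThan)
qed

text \<open>The vertices of the lowest \<open>n div 10\<close> ranks suffice: they are pairwise
  close, they form at least \<open>n^2 / 400\<close> ordered pairs, and each pair contributes at
  least \<open>1/400\<close>.\<close>

lemma sum_dev_square_ge:
  assumes \<rho>: "bij_betw \<rho> {..<n} {..<n}" and n: "400 \<le> n"
  shows "(\<Sum>a<n. \<Sum>b<n. dev n (\<rho> a) (\<rho> b) * dev n (\<rho> a) (\<rho> b)) \<ge> (real n)\<^sup>2 / 160000"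
proof -
  define w where "w = n div 10"
  define S where "S = {b. b < n \<and> \<rho> b < w}"
  have S: "card S = w" "S \<subseteq> {..<n}" "finite S"
    using card_rank_lessThan[OF \<rho>, of w] by (auto simp: S_def w_def)
  have w: "real w \<ge> real n / 20 + 1" "real w \<le> real n / 10"
    using n unfolding w_def by linarith+
  have "real w * (real w - 1) \<ge> (real n / 20) * (real n / 20)"
    using w n by (intro mult_mono) auto
  then have "(real n)\<^sup>2 / 160000 \<le> (\<Sum>a\<in>S. \<Sum>b\<in>S - {a}. 1/20 * (1/20 :: real))"
    using S w n by (simp add: power2_eq_square of_nat_diff) 
  also have "\<dots> \<le> (\<Sum>a\<in>S. \<Sum>b\<in>S - {a}. dev n (\<rho> a) (\<rho> b) * dev n (\<rho> a) (\<rho> b))"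
  proof (intro sum_mono)
    fix a b assume ab: "a \<in> S" "b \<in> S - {a}"
    then have "\<rho> a \<noteq> \<rho> b" 
      using bij_betw_imp_inj_on[OF \<rho>] S(2) by (auto simp: inj_on_def)
    moreover have "\<rho> a < w" "\<rho> b < w" "w \<le> n" using ab by (auto simp: S_def w_def)
    ultimately have "1/20 \<le> dev n (\<rho> a) (\<rho> b)"
      using n w by (intro dev_ge_of_close) linarith+
    then show "1/20 * (1/20) \<le> dev n (\<rho> a) (\<rho> b) * dev n (\<rho> a) (\<rho> b)"
      by (intro mult_mono) auto
  qed
  also have "\<dots> \<le> (\<Sum>a\<in>S. \<Sum>b<n. dev n (\<rho> a) (\<rho> b) * dev n (\<rho> a) (\<rho> b))"
    using S by (intro sum_mono sum_mono2) auto
  also have "\<dots> \<le> (\<Sum>a<n. \<Sum>b<n. dev n (\<rho> a) (\<rho> b) * dev n (\<rho> a) (\<rho> b))"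
    using S by (intro sum_mono2 sum_nonneg) auto
  finally show ?thesis .
qed

section \<open>From balanced counts to small total deviations\<close>

definition rank_sep :: "(nat \<Rightarrow> nat) \<Rightarrow> nat \<Rightarrow> nat \<Rightarrow> nat \<Rightarrow> nat \<Rightarrow> bool" where
  "rank_sep \<rho> a b c d \<longleftrightarrow> max (\<rho> a) (\<rho> b) < min (\<rho> c) (\<rho> d) \<or> max (\<rho> c) (\<rho> d) < min (\<rho> a) (\<rho> b)"

text \<open>The separated pairing is the one that puts the two lowest ranks together. The proof runs
  through all strict orderings of the four ranks.\<close>

lemma rank_sep_three_pairings:
  assumes "distinct [\<rho> a, \<rho> b, \<rho> c, \<rho> d]"
  shows "of_bool (rank_sep \<rho> a b c d) + of_bool (rank_sep \<rho> a c b d) + of_bool (rank_sep \<rho> a d b c) = (1 :: real)"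
proof -
  have "\<exists>w x y z. \<rho> a = w \<and> \<rho> b = x \<and> \<rho> c = y \<and> \<rho> d = z" by simp
  then obtain w x y z where [simp]: "\<rho> a = w" "\<rho> b = x" "\<rho> c = y" "\<rho> d = z" by blast
  have "(w < x \<or> x < w) \<and> (w < y \<or> y < w) \<and> (w < z \<or> z < w) \<and> (x < y \<or> y < x) \<and> (x < z \<or> z < x) \<and> (y < z \<or> z < y)"
    using assms by auto
  then show ?thesis
    unfolding rank_sep_def by (elim conjE disjE) simp_all
qed

lemma card_offdiag:
  assumes "finite L"
  shows "real (card {(c, d). c \<in> L \<and> d \<in> L \<and> c \<noteq> d}) = real (card L) * (real (card L) - 1)"
proof -
  have "{(c, d). c \<in> L \<and> d \<in> L \<and> c \<noteq> d} = (SIGMA c:L. L - {c})" by auto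
  then have "card {(c, d). c \<in> L \<and> d \<in> L \<and> c \<noteq> d} = card L * (card L - 1)"
    using assms by simp
  then show ?thesis
    by (cases "card L") (auto simp: algebra_simps)
qed

lemma card_rank_greaterThan:
  assumes \<rho>: "bij_betw \<rho> {..<n} {..<n}" and "m < n"
  shows "real (card {b. b < n \<and> m < \<rho> b}) = real n - 1 - real m"
proof -
  have eq: "{b. b < n \<and> m < \<rho> b} = {..<n} - {b. b < n \<and> \<rho> b < Suc m}" by auto
  have "card {b. b < n \<and> m < \<rho> b} = card {..<n} - card {b. b < n \<and> \<rho> b < Suc m}"
    unfolding eq by (rule card_Diff_subset) auto
  then have "card {b. b < n \<and> m < \<rho> b} = n - Suc m"
    using card_rank_lessThan[OF \<rho>, of "Suc m"] assms(2) by simp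
  then show ?thesis using assms(2) by simp
qed

text \<open>A separated pair lies wholly below the smaller or wholly above the larger of the two
  ranks. Such vertices differ from \<open>a\<close> and \<open>b\<close> automatically, so only the
  sizes of these two ends matter.\<close>

lemma card_rank_sep:
  assumes \<rho>: "bij_betw \<rho> {..<n} {..<n}" and ab: "a < n" "b < n" "a \<noteq> b"
  shows "real (card {(c, d). c \<in> {..<n} - {a, b} \<and> d \<in> {..<n} - {a, b} \<and> c \<noteq> d \<and> rank_sep \<rho> a b c d}) =
    sep_kernel n (\<rho> a) (\<rho> b)"
proof -
  define p where "p = min (\<rho> a) (\<rho> b)"
  define q where "q = max (\<rho> a) (\<rho> b)"
  have pq: "p \<le> q" "q < n"
    using bij_betwE[OF \<rho>] ab by (auto simp: p_def q_def)
  define L where "L = {c. c < n \<and> \<rho> c < p}"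
  define U where "U = {c. c < n \<and> q < \<rho> c}"
  have "{(c, d). c \<in> {..<n} - {a, b} \<and> d \<in> {..<n} - {a, b} \<and> c \<noteq> d \<and> rank_sep \<rho> a b c d} =
      {(c, d). c \<in> L \<and> d \<in> L \<and> c \<noteq> d} \<union> {(c, d). c \<in> U \<and> d \<in> U \<and> c \<noteq> d}"
    unfolding rank_sep_def L_def U_def p_def q_def by auto
  also have "card \<dots> = card {(c, d). c \<in> L \<and> d \<in> L \<and> c \<noteq> d} + card {(c, d). c \<in> U \<and> d \<in> U \<and> c \<noteq> d}"
  proof (rule card_Un_disjoint)
    have "finite L" "finite U" by (auto simp: L_def U_def)
    then have "finite (L \<times> L)" "finite (U \<times> U)" by auto
    then show "finite {(c, d). c \<in> L \<and> d \<in> L \<and> c \<noteq> d}" "finite {(c, d). c \<in> U \<and> d \<in> U \<and> c \<noteq> d}"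
      by (auto elim: rev_finite_subset)
    show "{(c, d). c \<in> L \<and> d \<in> L \<and> c \<noteq> d} \<inter> {(c, d). c \<in> U \<and> d \<in> U \<and> c \<noteq> d} = {}"
      using pq by (auto simp: L_def U_def)
  qed
  also have "real \<dots> = real p * (real p - 1) + (real n - 1 - real q) * (real n - 1 - real q - 1)"
  proof -
    have "card L = p" "real (card U) = real n - 1 - real q" "finite L" "finite U"
      using card_rank_lessThan[OF \<rho>, of p] card_rank_greaterThan[OF \<rho>, of q] pq
      by (simp_all add: L_def U_def)
    then show ?thesis by (simp add: card_offdiag)
  qed
  also have "\<dots> = sep_kernel n p q" using pq by (simp add: sep_kernel_eq)
  also have "\<dots> = sep_kernel n (\<rho> a) (\<rho> b)"
    by (auto simp: p_def q_def min_def max_def sep_kernel_commute)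
  finally show ?thesis .
qed

definition rank_count :: "nat \<Rightarrow> (nat \<Rightarrow> nat \<Rightarrow> nat) \<Rightarrow> nat \<Rightarrow> nat \<Rightarrow> nat \<Rightarrow> nat \<Rightarrow> nat" where
  "rank_count k \<rho> a b c d = card {i. i < k \<and> rank_sep (\<rho> i) a b c d}"

lemma rank_count_eq_sum:
  "real (rank_count k \<rho> a b c d) = (\<Sum>i<k. of_bool (rank_sep (\<rho> i) a b c d))"
proof -
  have "{..<k} \<inter> {i. rank_sep (\<rho> i) a b c d} = {i. i < k \<and> rank_sep (\<rho> i) a b c d}" by auto
  then show ?thesis by (simp add: rank_count_def)
qed

text \<open>The counts of the three pairings of a quadruple add up to \<open>k\<close> and differ by
  at most \<open>\<Delta>\<close>, so each is within \<open>\<Delta>\<close> of their mean.\<close>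

lemma rank_count_near_third:
  assumes \<rho>: "\<And>i. i < k \<Longrightarrow> bij_betw (\<rho> i) {..<n} {..<n}"
    and bal: "\<And>a b c d a' b' c' d'. {a, b, c, d, a', b', c', d'} \<subseteq> {..<n} \<Longrightarrow>
      distinct [a, b, c, d] \<Longrightarrow> distinct [a', b', c', d'] \<Longrightarrow>
      real (rank_count k \<rho> a b c d) \<le> real (rank_count k \<rho> a' b' c' d') + \<Delta>"
    and abcd: "{a, b, c, d} \<subseteq> {..<n}" "distinct [a, b, c, d]" and "0 \<le> \<Delta>"
  shows "\<bar>real (rank_count k \<rho> a b c d) - real k / 3\<bar> \<le> \<Delta>"
proof -
  have "real (rank_count k \<rho> a b c d) + real (rank_count k \<rho> a c b d) + real (rank_count k \<rho> a d b c) =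
    (\<Sum>i<k. of_bool (rank_sep (\<rho> i) a b c d) + of_bool (rank_sep (\<rho> i) a c b d) + of_bool (rank_sep (\<rho> i) a d b c))"
    unfolding rank_count_eq_sum by (simp add: sum.distrib)
  also have "\<dots> = (\<Sum>i<k. 1)"
  proof (intro sum.cong refl rank_sep_three_pairings)
    fix i assume "i \<in> {..<k}"
    then have "inj_on (\<rho> i) {..<n}" using \<rho> bij_betw_imp_inj_on by auto
    then show "distinct [\<rho> i a, \<rho> i b, \<rho> i c, \<rho> i d]"
      using abcd by (auto simp: inj_on_def)
  qed
  finally have "real (rank_count k \<rho> a b c d) + real (rank_count k \<rho> a c b d) + real (rank_count k \<rho> a d b c) = real k"
    by simp
  moreover have "real (rank_count k \<rho> a b c d) \<le> real (rank_count k \<rho> a c b d) + \<Delta>"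
    "real (rank_count k \<rho> a b c d) \<le> real (rank_count k \<rho> a d b c) + \<Delta>"
    "real (rank_count k \<rho> a c b d) \<le> real (rank_count k \<rho> a b c d) + \<Delta>"
    "real (rank_count k \<rho> a d b c) \<le> real (rank_count k \<rho> a b c d) + \<Delta>"
    using abcd by (auto intro!: bal)
  ultimately show ?thesis using assms(5) by (simp add: abs_le_iff)
qed

text \<open>Double counting: the total deviation at \<open>a\<close>, \<open>b\<close> is the
  average of \<open>rank_count k \<rho> a b c d - k / 3\<close> over all ordered pairs of distinct
  \<open>c\<close>, \<open>d\<close> outside \<open>{a, b}\<close>, and each averaged term is at
  most \<open>\<Delta>\<close> in absolute value.\<close>

lemma sum_dev_abs_le:
  assumes \<rho>: "\<And>i. i < k \<Longrightarrow> bij_betw (\<rho> i) {..<n} {..<n}"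
    and near: "\<And>a b c d. {a, b, c, d} \<subseteq> {..<n} \<Longrightarrow> distinct [a, b, c, d] \<Longrightarrow>
      \<bar>real (rank_count k \<rho> a b c d) - real k / 3\<bar> \<le> \<Delta>"
    and ab: "a < n" "b < n" "a \<noteq> b" and n: "4 \<le> n"
  shows "\<bar>\<Sum>i<k. dev n (\<rho> i a) (\<rho> i b)\<bar> \<le> \<Delta>"
proof -
  define W where "W = {..<n} - {a, b}"
  define P where "P = {(c, d). c \<in> W \<and> d \<in> W \<and> c \<noteq> d}"
  define N where "N = (real n - 2) * (real n - 3)"
  have N: "N > 0" using n by (simp add: N_def)
  have finW: "finite W" by (simp add: W_def)
  have "card W = n - 2" using ab by (simp add: W_def card_Diff_subset)
  then have W: "real (card W) = real n - 2" using n by simp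
  have "P \<subseteq> W \<times> W" by (auto simp: P_def)
  then have finP: "finite P" by (rule finite_subset) (simp add: W_def)
  have P: "real (card P) = N"
    using card_offdiag[of W] unfolding P_def N_def W by (simp add: finW)
  have sep_kernel: "sep_kernel n (\<rho> i a) (\<rho> i b) = (\<Sum>(c, d)\<in>P. of_bool (rank_sep (\<rho> i) a b c d))" if "i < k" for i
  proof -
    have "P \<inter> {x. case x of (c, d) \<Rightarrow> rank_sep (\<rho> i) a b c d} =
      {(c, d). c \<in> {..<n} - {a, b} \<and> d \<in> {..<n} - {a, b} \<and> c \<noteq> d \<and> rank_sep (\<rho> i) a b c d}"
      by (auto simp: P_def W_def)
    then show ?thesis
      using card_rank_sep[OF \<rho>[OF that] ab] finP by (simp add: case_prod_unfold)
  qed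
  have "(\<Sum>i<k. dev n (\<rho> i a) (\<rho> i b)) = (\<Sum>i<k. sep_kernel n (\<rho> i a) (\<rho> i b) / N - 1/3)"
  proof (intro sum.cong refl)
    fix i assume "i \<in> {..<k}"
    then have "inj_on (\<rho> i) {..<n}" using \<rho> bij_betw_imp_inj_on by auto
    then have "\<rho> i a \<noteq> \<rho> i b" using ab by (auto simp: inj_on_def)
    then show "dev n (\<rho> i a) (\<rho> i b) = sep_kernel n (\<rho> i a) (\<rho> i b) / N - 1/3"
      by (simp add: dev_def N_def)
  qed
  also have "\<dots> = (\<Sum>i<k. \<Sum>(c, d)\<in>P. of_bool (rank_sep (\<rho> i) a b c d)) / N - real k / 3"
    using sep_kernel by (simp add: sum_subtractf sum_divide_distrib)
  also have "(\<Sum>i<k. \<Sum>(c, d)\<in>P. of_bool (rank_sep (\<rho> i) a b c d)) = (\<Sum>(c, d)\<in>P. real (rank_count k \<rho> a b c d))"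
    unfolding rank_count_eq_sum by (subst sum.swap) (simp add: case_prod_unfold)
  finally have "(\<Sum>i<k. dev n (\<rho> i a) (\<rho> i b)) = (\<Sum>(c, d)\<in>P. real (rank_count k \<rho> a b c d)) / N - real k / 3" .
  also have "\<dots> = (\<Sum>(c, d)\<in>P. real (rank_count k \<rho> a b c d) - real k / 3) / N"
    using N P by (simp add: case_prod_unfold sum_subtractf diff_divide_distrib)
  finally have eq: "(\<Sum>i<k. dev n (\<rho> i a) (\<rho> i b)) = (\<Sum>(c, d)\<in>P. real (rank_count k \<rho> a b c d) - real k / 3) / N" .
  have "\<bar>\<Sum>(c, d)\<in>P. real (rank_count k \<rho> a b c d) - real k / 3\<bar> \<le> (\<Sum>(c, d)\<in>P. \<Delta>)"
    unfolding case_prod_unfold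
  proof (rule order_trans[OF sum_abs], rule sum_mono)
    fix x assume "x \<in> P"
    then show "\<bar>real (rank_count k \<rho> a b (fst x) (snd x)) - real k / 3\<bar> \<le> \<Delta>"
      using ab by (intro near) (auto simp: P_def W_def)
  qed
  also have "\<dots> = N * \<Delta>" using P by (simp add: case_prod_unfold)
  finally show ?thesis
    unfolding eq using N by (simp add: abs_divide divide_le_eq mult.commute)
qed

section \<open>Second moment bound on the number of orders\<close>

lemma sum_sum_square_swap:
  fixes f :: "nat \<Rightarrow> nat \<Rightarrow> nat \<Rightarrow> real"
  shows "(\<Sum>a<n. \<Sum>b<n. (\<Sum>i<k. f i a b)\<^sup>2) = (\<Sum>i<k. \<Sum>j<k. \<Sum>a<n. \<Sum>b<n. f i a b * f j a b)"
proof -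
  have "(\<Sum>a<n. \<Sum>b<n. (\<Sum>i<k. f i a b)\<^sup>2) = (\<Sum>a<n. \<Sum>b<n. \<Sum>i<k. \<Sum>j<k. f i a b * f j a b)"
    by (simp add: power2_eq_square sum_product)
  also have "\<dots> = (\<Sum>a<n. \<Sum>i<k. \<Sum>b<n. \<Sum>j<k. f i a b * f j a b)"
    by (intro sum.cong refl sum.swap)
  also have "\<dots> = (\<Sum>i<k. \<Sum>a<n. \<Sum>b<n. \<Sum>j<k. f i a b * f j a b)"
    by (rule sum.swap)
  also have "\<dots> = (\<Sum>i<k. \<Sum>a<n. \<Sum>j<k. \<Sum>b<n. f i a b * f j a b)"
    by (intro sum.cong refl sum.swap)
  also have "\<dots> = (\<Sum>i<k. \<Sum>j<k. \<Sum>a<n. \<Sum>b<n. f i a b * f j a b)"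
    by (intro sum.cong refl sum.swap)
  finally show ?thesis .
qed

text \<open>Second moment of the total deviation matrix: its diagonal terms contribute order \<open>k n\<^sup>2\<close>, its
  cross terms lose only order \<open>k\<^sup>2 n\<close>.\<close>

lemma family_size_le_square:
  assumes \<rho>: "\<And>i. i < k \<Longrightarrow> bij_betw (\<rho> i) {..<n} {..<n}"
    and dev: "\<And>a b. a < n \<Longrightarrow> b < n \<Longrightarrow> a \<noteq> b \<Longrightarrow> \<bar>\<Sum>i<k. dev n (\<rho> i a) (\<rho> i b)\<bar> \<le> \<Delta>"
    and n: "400 \<le> n" and k: "3200000 * k \<le> n"
  shows "real k \<le> 320000 * \<Delta>\<^sup>2"
proof -
  have "(\<Sum>a<n. \<Sum>b<n. (\<Sum>i<k. dev n (\<rho> i a) (\<rho> i b))\<^sup>2) \<le> (\<Sum>a<n. \<Sum>b<n. \<Delta>\<^sup>2)"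
  proof (intro sum_mono)
    fix a b assume ab: "a \<in> {..<n}" "b \<in> {..<n}"
    show "(\<Sum>i<k. dev n (\<rho> i a) (\<rho> i b))\<^sup>2 \<le> \<Delta>\<^sup>2"
    proof (cases "a = b")
      case True
      then show ?thesis by (simp add: dev_def)
    next
      case False
      then have "\<bar>\<Sum>i<k. dev n (\<rho> i a) (\<rho> i b)\<bar> \<le> \<Delta>" using dev ab by auto
      then show ?thesis by (metis abs_ge_zero power2_abs power_mono)
    qed
  qed
  also have "\<dots> = (real n)\<^sup>2 * \<Delta>\<^sup>2" by (simp add: power2_eq_square)
  finally have up: "(\<Sum>i<k. \<Sum>j<k. \<Sum>a<n. \<Sum>b<n. dev n (\<rho> i a) (\<rho> i b) * dev n (\<rho> j a) (\<rho> j b)) \<le> (real n)\<^sup>2 * \<Delta>\<^sup>2"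
    by (simp add: sum_sum_square_swap)
  have "(\<Sum>i<k. \<Sum>j<k. (if i = j then (real n)\<^sup>2 / 160000 else 0) - 10 * real n) \<le>
     (\<Sum>i<k. \<Sum>j<k. \<Sum>a<n. \<Sum>b<n. dev n (\<rho> i a) (\<rho> i b) * dev n (\<rho> j a) (\<rho> j b))"
  proof (intro sum_mono)
    fix i j assume ij: "i \<in> {..<k}" "j \<in> {..<k}"
    show "(if i = j then (real n)\<^sup>2 / 160000 else 0) - 10 * real n \<le>
      (\<Sum>a<n. \<Sum>b<n. dev n (\<rho> i a) (\<rho> i b) * dev n (\<rho> j a) (\<rho> j b))"
    proof (cases "i = j")
      case True
      then show ?thesis using sum_dev_square_ge[OF \<rho> n, of i] ij by simp
    next
      case False
      then show ?thesis using dev_inner_ge[OF \<rho> \<rho>, of j i] ij n by simp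
    qed
  qed
  also have "(\<Sum>i<k. \<Sum>j<k. (if i = j then (real n)\<^sup>2 / 160000 else 0) - 10 * real n) =
     real k * ((real n)\<^sup>2 / 160000) - 10 * real n * (real k * real k)"
  proof -
    have "(\<Sum>j<k. (if i = j then (real n)\<^sup>2 / 160000 else 0) - 10 * real n) =
      (real n)\<^sup>2 / 160000 - real k * (10 * real n)" if "i < k" for i
      using that by (simp add: sum_subtractf)
    then have "(\<Sum>i<k. \<Sum>j<k. (if i = j then (real n)\<^sup>2 / 160000 else 0) - 10 * real n) =
      (\<Sum>i<k. (real n)\<^sup>2 / 160000 - real k * (10 * real n))"
      by (intro sum.cong) auto
    then show ?thesis by (simp add: algebra_simps)
  qed
  finally have "real k * ((real n)\<^sup>2 / 160000) - 10 * real n * (real k * real k) \<le> (real n)\<^sup>2 * \<Delta>\<^sup>2"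
    using up by linarith
  \<comment> \<open>Since \<open>3200000 = 2 * 10 * 160000\<close>, the cross terms consume at most
    half of the diagonal contribution; the other half yields the factor
    \<open>320000\<close>.\<close>
  moreover have "10 * real n * real k * (3200000 * real k) \<le> 10 * real n * real k * real n"
    using k by (intro mult_left_mono) (auto simp: of_nat_mult[symmetric] simp del: of_nat_mult)
  ultimately have "(real n)\<^sup>2 * real k \<le> (real n)\<^sup>2 * (320000 * \<Delta>\<^sup>2)"
    by (simp add: power2_eq_square algebra_simps)
  then show ?thesis using n by (subst (asm) mult_le_cancel_left_pos) auto
qed

section \<open>Vertices that are close in many orders\<close>

text \<open>Pigeonhole, stated as a product so that repeated use multiplies the factors without
  rounding.\<close>

lemma exists_large_fibre:
  fixes f :: "'a \<Rightarrow> nat"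
  assumes "finite S" "f ` S \<subseteq> {..<m}"
  shows "\<exists>j. card S \<le> card {x \<in> S. f x = j} * m"
proof (rule ccontr)
  assume "\<not> ?thesis"
  then have lt: "card {x \<in> S. f x = j} * m < card S" for j by (simp add: not_le)
  then have "m > 0" using assms by (cases "m = 0") auto
  have "S = (\<Union>j<m. {x \<in> S. f x = j})" using assms(2) by auto
  then have "card S \<le> (\<Sum>j<m. card {x \<in> S. f x = j})"
    by (metis card_UN_le finite_lessThan)
  then have "card S * m \<le> (\<Sum>j<m. card {x \<in> S. f x = j} * m)"
    by (metis mult_le_mono1 sum_distrib_right)
  also have "\<dots> < (\<Sum>j<m. card S)"
    using lt \<open>m > 0\<close> by (intro sum_strict_mono) auto
  finally show False by (simp add: mult.commute)
qed

text \<open>Cut the ranks of each order into blocks of length \<open>n div 10\<close> and keep the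
  block holding most of the current set. Each order costs a factor of at most
  \<open>16\<close>.\<close>

lemma exists_cluster:
  assumes n: "400 \<le> n" and \<rho>: "\<And>i. i < T \<Longrightarrow> bij_betw (\<rho> i) {..<n} {..<n}"
  shows "\<exists>S \<subseteq> {..<n}. n \<le> card S * 16 ^ T \<and>
    (\<forall>i<T. \<forall>a\<in>S. \<forall>b\<in>S. \<bar>real (\<rho> i a) - real (\<rho> i b)\<bar> \<le> real n / 10)"
  using \<rho>
proof (induction T)
  case 0
  then show ?case by (intro exI[of _ "{..<n}"]) auto
next
  case (Suc T)
  then obtain S where S: "S \<subseteq> {..<n}" "n \<le> card S * 16 ^ T"
    "\<forall>i<T. \<forall>a\<in>S. \<forall>b\<in>S. \<bar>real (\<rho> i a) - real (\<rho> i b)\<bar> \<le> real n / 10"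
    by auto
  define w where "w = n div 10"
  \<comment> \<open>Allowing \<open>16\<close> blocks instead of \<open>10\<close> absorbs the
    rounding in \<open>n div 10\<close>, and a power of two suits the later comparison with
    \<open>2 powr l\<close>.\<close>
  have w: "w > 0" "n \<le> 16 * w" "10 * w \<le> n" using n by (auto simp: w_def)
  have "\<rho> T a div w < 16" if "a \<in> S" for a
  proof -
    have "\<rho> T a < n" using bij_betwE[OF Suc.prems[of T]] S(1) that by auto
    then show ?thesis using w by (intro less_mult_imp_div_less) linarith
  qed
  then obtain j where j: "card S \<le> card {a \<in> S. \<rho> T a div w = j} * 16"
    using exists_large_fibre[of S "\<lambda>a. \<rho> T a div w" 16] S(1) finite_subset by blast
  define S' where "S' = {a \<in> S. \<rho> T a div w = j}"
  have close: "\<bar>real (\<rho> T a) - real (\<rho> T b)\<bar> \<le> real n / 10" if ab: "a \<in> S'" "b \<in> S'" for a b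
  proof -
    have "\<rho> T a div w * w = \<rho> T b div w * w" using ab by (simp add: S'_def)
    then have "\<rho> T a < \<rho> T b + w" "\<rho> T b < \<rho> T a + w"
      using w(1) div_mult_mod_eq[of "\<rho> T a" w] div_mult_mod_eq[of "\<rho> T b" w]
        mod_less_divisor[OF w(1), of "\<rho> T a"] mod_less_divisor[OF w(1), of "\<rho> T b"] by linarith+
    then show ?thesis using w(3) by linarith
  qed
  have "n \<le> card S' * 16 * 16 ^ T"
    using S(2) mult_le_mono1[OF j, of "16 ^ T"] unfolding S'_def by linarith
  moreover have "\<forall>i<Suc T. \<forall>a\<in>S'. \<forall>b\<in>S'. \<bar>real (\<rho> i a) - real (\<rho> i b)\<bar> \<le> real n / 10"
    using S(3) close by (auto simp: less_Suc_eq S'_def)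
  moreover have "S' \<subseteq> {..<n}" using S(1) by (auto simp: S'_def)
  ultimately show ?case by (intro exI[of _ S']) (auto simp: mult.assoc)
qed

text \<open>Sum all deviations over \<open>S \<times> S\<close>, with \<open>m = card S\<close>. The
  first \<open>T\<close> orders contribute about \<open>m * (m - 1) / 20\<close> each. By
  \<open>dev_form_ge\<close> at the indicator vector of \<open>S\<close>, each other order loses at
  most \<open>3 * m\<close>. The total is at most \<open>m * (m - 1) * \<Delta>\<close>, and a
  factor \<open>m\<close> cancels.\<close>

lemma cluster_bound:
  assumes \<rho>: "\<And>i. i < k \<Longrightarrow> bij_betw (\<rho> i) {..<n} {..<n}"
    and dev: "\<And>a b. a < n \<Longrightarrow> b < n \<Longrightarrow> a \<noteq> b \<Longrightarrow> \<bar>\<Sum>i<k. dev n (\<rho> i a) (\<rho> i b)\<bar> \<le> \<Delta>"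
    and n: "400 \<le> n" and T: "T \<le> k" and S: "S \<subseteq> {..<n}" "S \<noteq> {}"
    and close: "\<And>i a b. i < T \<Longrightarrow> a \<in> S \<Longrightarrow> b \<in> S \<Longrightarrow> \<bar>real (\<rho> i a) - real (\<rho> i b)\<bar> \<le> real n / 10"
  shows "real T / 20 * (real (card S) - 1) \<le> \<Delta> * (real (card S) - 1) + 3 * real k"
proof -
  define m where "m = real (card S)"
  have fin: "finite S" using S(1) finite_subset by blast
  then have "card S > 0" using S(2) by (simp add: card_gt_0_iff)
  then have m: "m > 0" "real (card S - 1) = m - 1" by (auto simp: m_def)
  have offdiag: "(\<Sum>a\<in>S. \<Sum>b\<in>S. f a b) = (\<Sum>a\<in>S. \<Sum>b\<in>S - {a}. f a b)" if "\<And>a. f a a = 0" for f :: "nat \<Rightarrow> nat \<Rightarrow> real"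
    using fin that by (intro sum.cong refl sum.mono_neutral_right) auto
  have const: "(\<Sum>a\<in>S. \<Sum>b\<in>S - {a}. x) = m * (m - 1) * x" for x :: real
    using fin m by (simp add: m_def)
  have low: "(\<Sum>a\<in>S. \<Sum>b\<in>S. dev n (\<rho> i a) (\<rho> i b)) \<ge> (if i < T then m * (m - 1) / 20 else 0) - 3 * m"
    if i: "i < k" for i
  proof (cases "i < T")
    case True
    have "(\<Sum>a\<in>S. \<Sum>b\<in>S - {a}. 1/20) \<le> (\<Sum>a\<in>S. \<Sum>b\<in>S - {a}. dev n (\<rho> i a) (\<rho> i b))"
    proof (intro sum_mono dev_ge_of_close n)
      fix a b assume ab: "a \<in> S" "b \<in> S - {a}"
      show "\<rho> i a < n" "\<rho> i b < n" using bij_betwE[OF \<rho>[OF i]] ab S(1) by auto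
      show "\<rho> i a \<noteq> \<rho> i b"
        using bij_betw_imp_inj_on[OF \<rho>[OF i]] ab S(1) by (auto simp: inj_on_def)
      show "\<bar>real (\<rho> i a) - real (\<rho> i b)\<bar> \<le> real n / 10" using close[OF True] ab by auto
    qed
    then show ?thesis
      unfolding const using True m(1) offdiag[of "\<lambda>a b. dev n (\<rho> i a) (\<rho> i b)"] by (simp add: dev_def[of n "\<rho> i a" "\<rho> i a" for a])
  next
    case False
    have "(\<Sum>a<n. \<Sum>b<n. of_bool (a \<in> S) * of_bool (b \<in> S) * dev n (\<rho> i a) (\<rho> i b)) =
        (\<Sum>a\<in>S. \<Sum>b<n. of_bool (a \<in> S) * of_bool (b \<in> S) * dev n (\<rho> i a) (\<rho> i b))"
      using S by (intro sum.mono_neutral_right) auto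
    also have "\<dots> = (\<Sum>a\<in>S. \<Sum>b\<in>S. dev n (\<rho> i a) (\<rho> i b))"
      using S by (intro sum.cong refl sum.mono_neutral_cong_right) auto
    finally have "(\<Sum>a\<in>S. \<Sum>b\<in>S. dev n (\<rho> i a) (\<rho> i b)) \<ge> - 3 * (\<Sum>a<n. (of_bool (a \<in> S))\<^sup>2)"
      using dev_form_ge[OF \<rho>[OF i], of "\<lambda>a. of_bool (a \<in> S)"] n by simp
    also have "(\<Sum>a<n. (of_bool (a \<in> S))\<^sup>2) = (\<Sum>a\<in>S. 1 :: real)"
      using S by (intro sum.mono_neutral_cong_right) auto
    finally show ?thesis using False by (simp add: m_def)
  qed
  have "(\<Sum>i<k. (if i < T then m * (m - 1) / 20 else 0) - 3 * m) \<le> (\<Sum>i<k. \<Sum>a\<in>S. \<Sum>b\<in>S. dev n (\<rho> i a) (\<rho> i b))"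
    using low by (intro sum_mono) auto
  also have "\<dots> = (\<Sum>a\<in>S. \<Sum>i<k. \<Sum>b\<in>S. dev n (\<rho> i a) (\<rho> i b))"
    by (rule sum.swap)
  also have "\<dots> = (\<Sum>a\<in>S. \<Sum>b\<in>S. \<Sum>i<k. dev n (\<rho> i a) (\<rho> i b))"
    by (intro sum.cong refl sum.swap)
  also have "\<dots> = (\<Sum>a\<in>S. \<Sum>b\<in>S - {a}. \<Sum>i<k. dev n (\<rho> i a) (\<rho> i b))"
    by (rule offdiag) (simp add: dev_def)
  also have "\<dots> \<le> (\<Sum>a\<in>S. \<Sum>b\<in>S - {a}. \<Delta>)"
  proof (intro sum_mono)
    fix a b assume "a \<in> S" "b \<in> S - {a}"
    then have "\<bar>\<Sum>i<k. dev n (\<rho> i a) (\<rho> i b)\<bar> \<le> \<Delta>" using S(1) by (intro dev) auto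
    then show "(\<Sum>i<k. dev n (\<rho> i a) (\<rho> i b)) \<le> \<Delta>" by simp
  qed
  also have "\<dots> = m * (m - 1) * \<Delta>" by (rule const)
  also have "(\<Sum>i<k. (if i < T then m * (m - 1) / 20 else 0) - 3 * m) =
      real T * (m * (m - 1) / 20) - real k * (3 * m)"
  proof -
    have "(\<Sum>i<k. if i < T then m * (m - 1) / 20 else 0) = (\<Sum>i<T. m * (m - 1) / 20)"
      using T by (intro sum.mono_neutral_cong_right) auto
    then show ?thesis by (simp add: sum_subtractf)
  qed
  finally have "m * (real T / 20 * (m - 1)) \<le> m * (\<Delta> * (m - 1) + 3 * real k)"
    by (simp add: algebra_simps)
  then show ?thesis using m(1) unfolding m_def[symmetric] by simp
qed

section \<open>Too few orders leave some pair unseparated\<close>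

text \<open>Raise a threshold until one of the sets first has \<open>s\<close> elements at or below
  it. These serve as one half; the elements of the other set above the threshold serve as the
  other.\<close>

lemma exists_separated_halves:
  fixes \<rho> :: "'a \<Rightarrow> nat"
  assumes fin: "finite A" "finite B" and inj: "inj_on \<rho> A" "inj_on \<rho> B"
    and card: "2 * s \<le> card A" "2 * s \<le> card B" and s: "1 \<le> s"
  shows "\<exists>A' B'. A' \<subseteq> A \<and> B' \<subseteq> B \<and> s \<le> card A' \<and> s \<le> card B' \<and>
    ((\<forall>a\<in>A'. \<forall>b\<in>B'. \<rho> a < \<rho> b) \<or> (\<forall>a\<in>A'. \<forall>b\<in>B'. \<rho> b < \<rho> a))"
proof -
  define P where "P t \<longleftrightarrow> s \<le> card {a \<in> A. \<rho> a < t} \<or> s \<le> card {b \<in> B. \<rho> b < t}" for t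
  have "{a \<in> A. \<rho> a < Suc (\<Sum>a\<in>A. \<rho> a)} = A"
    using fin member_le_sum[of _ A \<rho>] by (auto simp: less_Suc_eq_le)
  then have "P (Suc (\<Sum>a\<in>A. \<rho> a))" using card by (simp add: P_def)
  moreover have "\<not> P 0" using s by (simp add: P_def)
  ultimately obtain u where u: "\<not> P u" "P (Suc u)"
    by (metis Least_eq_0 LeastI not_less_Least ex_least_nat_less)
  have upper: "s \<le> card {c \<in> C. u < \<rho> c}"
    if C: "finite C" "inj_on \<rho> C" "2 * s \<le> card C" "card {c \<in> C. \<rho> c < u} < s" for C
  proof -
    \<comment> \<open>Of at least \<open>2 * s\<close> elements, at most \<open>s - 1\<close> have
      rank below \<open>u\<close> and, by injectivity, at most one has rank \<open>u\<close>; so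
      \<open>s\<close> remain above.\<close>
    have "card {c \<in> C. \<rho> c = u} \<le> 1"
      using C(1,2) by (auto simp: card_le_Suc0_iff_eq inj_on_def)
    moreover have "C = {c \<in> C. \<rho> c < u} \<union> {c \<in> C. \<rho> c = u} \<union> {c \<in> C. u < \<rho> c}" by auto
    then have "card C \<le> card {c \<in> C. \<rho> c < u} + card {c \<in> C. \<rho> c = u} + card {c \<in> C. u < \<rho> c}"
      by (metis (no_types, lifting) add_le_mono1 card_Un_le le_trans)
    ultimately show ?thesis using C(3,4) by linarith
  qed
  have "s \<le> card {a \<in> A. u < \<rho> a}" "s \<le> card {b \<in> B. u < \<rho> b}"
    using u(1) upper[of A] upper[of B] assms by (auto simp: P_def)
  then show ?thesis
    using u(2) unfolding P_def
  proof (elim disjE)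
    assume "s \<le> card {a \<in> A. \<rho> a < Suc u}" "s \<le> card {b \<in> B. u < \<rho> b}"
    then show ?thesis
      by (intro exI[of _ "{a \<in> A. \<rho> a < Suc u}"] exI[of _ "{b \<in> B. u < \<rho> b}"]) auto
  next
    assume "s \<le> card {b \<in> B. \<rho> b < Suc u}" "s \<le> card {a \<in> A. u < \<rho> a}"
    then show ?thesis
      by (intro exI[of _ "{b \<in> B. \<rho> b < Suc u}"] exI[of _ "{a \<in> A. u < \<rho> a}"]) auto
  qed
qed

text \<open>Each order halves both sets, so the induction generalises over \<open>s\<close>: sets of
  size \<open>2 * s\<close> for the first \<open>k\<close> orders are cut down to size
  \<open>s\<close> by the next one.\<close>

lemma exists_commonly_separated_sets:
  assumes "\<And>i. i < k \<Longrightarrow> inj_on (\<rho> i) {..<n}" "1 \<le> s" "2 * (s * 2 ^ k) \<le> n"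
  shows "\<exists>A B. A \<subseteq> {..<n} \<and> B \<subseteq> {..<n} \<and> A \<inter> B = {} \<and> s \<le> card A \<and> s \<le> card B \<and>
    (\<forall>i<k. (\<forall>a\<in>A. \<forall>b\<in>B. \<rho> i a < \<rho> i b) \<or> (\<forall>a\<in>A. \<forall>b\<in>B. (\<rho> i b :: nat) < \<rho> i a))"
  using assms
proof (induction k arbitrary: s)
  case 0
  then show ?case
    by (intro exI[of _ "{..<s}"] exI[of _ "{s..<2 * s}"]) auto
next
  case (Suc k)
  obtain A B where AB: "A \<subseteq> {..<n}" "B \<subseteq> {..<n}" "A \<inter> B = {}" "2 * s \<le> card A" "2 * s \<le> card B"
    "\<forall>i<k. (\<forall>a\<in>A. \<forall>b\<in>B. \<rho> i a < \<rho> i b) \<or> (\<forall>a\<in>A. \<forall>b\<in>B. \<rho> i b < \<rho> i a)"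
    using Suc.IH[of "2 * s"] Suc.prems by (auto simp: mult.assoc mult.left_commute)
  have inj: "inj_on (\<rho> k) {..<n}" using Suc.prems(1) by simp
  obtain A' B' where A'B': "A' \<subseteq> A" "B' \<subseteq> B" "s \<le> card A'" "s \<le> card B'"
    "(\<forall>a\<in>A'. \<forall>b\<in>B'. \<rho> k a < \<rho> k b) \<or> (\<forall>a\<in>A'. \<forall>b\<in>B'. \<rho> k b < \<rho> k a)"
    using exists_separated_halves[OF _ _ inj_on_subset[OF inj AB(1)] inj_on_subset[OF inj AB(2)]
      AB(4,5) Suc.prems(2)] AB(1,2)[THEN finite_subset] by auto
  have "(\<forall>a\<in>A'. \<forall>b\<in>B'. \<rho> i a < \<rho> i b) \<or> (\<forall>a\<in>A'. \<forall>b\<in>B'. \<rho> i b < \<rho> i a)" if "i < Suc k" for i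
  proof (cases "i = k")
    case True
    then show ?thesis using A'B'(5) by simp
  next
    case False
    then have "i < k" using that by simp
    then show ?thesis using AB(6) A'B'(1,2) by (meson subsetD)
  qed
  moreover have "A' \<subseteq> {..<n}" "B' \<subseteq> {..<n}" "A' \<inter> B' = {}" using AB(1-3) A'B'(1,2) by auto
  ultimately show ?case using A'B'(3,4) by blast
qed

text \<open>Take \<open>a\<close>, \<open>c\<close> in \<open>A\<close> and \<open>b\<close>,
  \<open>d\<close> in \<open>B\<close>. Every order places \<open>A\<close> and \<open>B\<close> on
  opposite sides, so the pairs \<open>{a, b}\<close> and \<open>{c, d}\<close>, each with one vertex
  per side, are never separated.\<close>

lemma exists_unseparated:
  assumes "\<And>i. i < k \<Longrightarrow> bij_betw (\<rho> i) {..<n} {..<n}" "4 * 2 ^ k \<le> n"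
  shows "\<exists>a b c d. {a, b, c, d} \<subseteq> {..<n} \<and> distinct [a, b, c, d] \<and> rank_count k \<rho> a b c d = 0"
proof -
  obtain A B where AB: "A \<subseteq> {..<n}" "B \<subseteq> {..<n}" "A \<inter> B = {}" "2 \<le> card A" "2 \<le> card B"
    "\<forall>i<k. (\<forall>a\<in>A. \<forall>b\<in>B. \<rho> i a < \<rho> i b) \<or> (\<forall>a\<in>A. \<forall>b\<in>B. \<rho> i b < \<rho> i a)"
  proof -
    have "inj_on (\<rho> i) {..<n}" if "i < k" for i
      using assms(1)[OF that] by (rule bij_betw_imp_inj_on)
    from exists_commonly_separated_sets[of k \<rho> n 2, OF this] assms(2) that show thesis by auto
  qed
  obtain a c where ac: "a \<in> A" "c \<in> A" "a \<noteq> c"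
    using AB(4) by (metis card_le_Suc0_iff_eq card.infinite not_less_eq_eq numeral_2_eq_2 zero_le)
  obtain b d where bd: "b \<in> B" "d \<in> B" "b \<noteq> d"
    using AB(5) by (metis card_le_Suc0_iff_eq card.infinite not_less_eq_eq numeral_2_eq_2 zero_le)
  have "\<not> rank_sep (\<rho> i) a b c d" if "i < k" for i
    using AB(6) ac bd that unfolding rank_sep_def by fastforce
  then have "rank_count k \<rho> a b c d = 0" by (auto simp: rank_count_def)
  then show ?thesis using ac bd AB by (intro exI[of _ a] exI[of _ b] exI[of _ c] exI[of _ d]) auto
qed

section \<open>Linear orders as rank functions\<close>

text \<open>The rank of \<open>x\<close> is the size of its set \<open>D x\<close> of strict
  predecessors. These sets grow strictly along the order, so ranks are distinct, and an injection of
  a finite set into itself is a bijection.\<close>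

lemma linear_order_rank:
  assumes r: "linear_order_on {..<n} r"
  shows "\<exists>\<rho>. bij_betw \<rho> {..<n} {..<n} \<and> (\<forall>x<n. \<forall>y<n. (x, y) \<in> r \<longleftrightarrow> \<rho> x \<le> (\<rho> y :: nat))"
proof -
  have r': "r \<subseteq> {..<n} \<times> {..<n}" "refl_on {..<n} r" "trans r" "antisym r" "total_on {..<n} r"
    using r by (auto simp: order_on_defs)
  define D where "D x = {y. (y, x) \<in> r \<and> y \<noteq> x}" for x
  have D: "D x \<subseteq> {..<n} - {x}" for x using r'(1) by (auto simp: D_def)
  have fin: "finite (D x)" for x using D finite_subset by blast
  have mono: "card (D x) < card (D y)" if "(x, y) \<in> r" "x \<noteq> y" for x y
  proof (rule psubset_card_mono[OF fin])
    have "x \<in> D y" "x \<notin> D x" using that by (auto simp: D_def)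
    moreover have "D x \<subseteq> D y"
      using that transD[OF r'(3)] antisymD[OF r'(4)] unfolding D_def by blast
    ultimately show "D x \<subset> D y" by blast
  qed
  have iff: "(x, y) \<in> r \<longleftrightarrow> card (D x) \<le> card (D y)" if "x < n" "y < n" for x y
  proof (cases "x = y")
    case True
    then show ?thesis using r'(2) that by (auto simp: refl_on_def)
  next
    case False
    then have "(x, y) \<in> r \<or> (y, x) \<in> r" using r'(5) that by (auto simp: total_on_def)
    then show ?thesis
      using False mono[of x y] mono[of y x] antisymD[OF r'(4)] by fastforce
  qed
  have inj: "inj_on (\<lambda>x. card (D x)) {..<n}"
    using iff antisymD[OF r'(4)] by (intro inj_onI) (metis lessThan_iff order_refl)
  have "card (D x) < n" if "x < n" for x
  proof -
    have "card (D x) \<le> card ({..<n} - {x})" using D by (intro card_mono) auto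
    then show ?thesis using that by simp
  qed
  then have "(\<lambda>x. card (D x)) ` {..<n} = {..<n}"
    using inj by (intro endo_inj_surj) auto
  then have "bij_betw (\<lambda>x. card (D x)) {..<n} {..<n}" using inj by (simp add: bij_betw_def)
  then show ?thesis using iff by (intro exI[of _ "\<lambda>x. card (D x)"]) auto
qed

text \<open>List positions account for multiplicity. Since the four vertices are distinct, the
  reflexive comparisons in \<open>separates\<close> agree with strict comparisons of ranks.\<close>

lemma sep_count_eq_rank_count:
  assumes \<rho>: "\<And>i. i < length rs \<Longrightarrow> bij_betw (\<rho> i) {..<n} {..<n}"
    and rs: "\<And>i x y. i < length rs \<Longrightarrow> x < n \<Longrightarrow> y < n \<Longrightarrow> (x, y) \<in> rs ! i \<longleftrightarrow> \<rho> i x \<le> \<rho> i y"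
    and abcd: "{a, b, c, d} \<subseteq> {..<n}" "distinct [a, b, c, d]"
  shows "sep_count (mset rs) {a, b} {c, d} = rank_count (length rs) \<rho> a b c d"
proof -
  have "separates (rs ! i) {a, b} {c, d} \<longleftrightarrow> rank_sep (\<rho> i) a b c d" if i: "i < length rs" for i
  proof -
    have "(x, y) \<in> rs ! i \<longleftrightarrow> \<rho> i x < \<rho> i y" if "x < n" "y < n" "x \<noteq> y" for x y
      using inj_onD[OF bij_betw_imp_inj_on[OF \<rho>[OF i]], of x y] rs[OF i] that
      by (auto simp: le_less)
    moreover have "a < n" "b < n" "c < n" "d < n" "a \<noteq> c" "a \<noteq> d" "b \<noteq> c" "b \<noteq> d"
      using abcd by auto
    ultimately show ?thesis
      unfolding separates_def rank_sep_def by simp blast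
  qed
  then have "{i. i < length rs \<and> separates (rs ! i) {a, b} {c, d}} =
      {i. i < length rs \<and> rank_sep (\<rho> i) a b c d}" by auto
  then show ?thesis
    by (simp add: sep_count_def rank_count_def mset_filter[symmetric] length_filter_conv_card del: mset_filter)
qed

section \<open>Combining the estimates for large and small \<open>n\<close>\<close>

lemma eventually_log_bounds:
  "\<forall>\<^sub>F n :: nat in sequentially. 400 \<le> n \<and> 3 * (log 2 (real n))\<^sup>2 \<le> sqrt (real n) - 1 \<and> 300 \<le> log 2 (real n)"
  by (intro eventually_conj eventually_ge_at_top) real_asymp+

lemma rank_family_size_ge:
  assumes \<rho>: "\<And>i. i < k \<Longrightarrow> bij_betw (\<rho> i) {..<n} {..<n}"
    and pos: "\<And>a b c d. {a, b, c, d} \<subseteq> {..<n} \<Longrightarrow> distinct [a, b, c, d] \<Longrightarrow> 0 < rank_count k \<rho> a b c d"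
    and bal: "\<And>a b c d a' b' c' d'. {a, b, c, d, a', b', c', d'} \<subseteq> {..<n} \<Longrightarrow>
      distinct [a, b, c, d] \<Longrightarrow> distinct [a', b', c', d'] \<Longrightarrow>
      real (rank_count k \<rho> a b c d) \<le> real (rank_count k \<rho> a' b' c' d') + \<Delta>"
    and \<Delta>: "0 \<le> \<Delta>" "\<Delta> \<le> log 2 (real n) / 1000"
    and n: "400 \<le> n" "3 * (log 2 (real n))\<^sup>2 \<le> sqrt (real n) - 1" "300 \<le> log 2 (real n)"
  shows "n < 3200000 * k"
proof (rule ccontr)
  assume "\<not> n < 3200000 * k"
  then have small: "3200000 * k \<le> n" by simp
  define l where "l = log 2 (real n)"
  \<comment> \<open>The divisor \<open>8\<close> makes \<open>16 ^ T\<close> at most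
    \<open>2 powr (l / 2) = sqrt n\<close>, so the cluster keeps at least \<open>sqrt n\<close>
    vertices.\<close>
  define T where "T = nat \<lfloor>l / 8\<rfloor>"
  have T: "real T \<le> l / 8" "l / 8 - 1 \<le> real T" using n(3) unfolding T_def l_def by linarith+
  have nl: "real n = 2 powr l" using n(1) by (simp add: l_def)
  have "(16::real) ^ T = 2 powr (4 * real T)"
    by (simp add: powr_mult_base powr_powr[symmetric] powr_realpow)
  also have "\<dots> \<le> 2 powr (l / 2)" using T(1) by simp
  also have "\<dots> = sqrt (real n)" by (simp add: nl powr_half_sqrt[symmetric] powr_powr)
  finally have T16: "(16::real) ^ T \<le> sqrt (real n)" .
  have dev: "\<bar>\<Sum>i<k. dev n (\<rho> i a) (\<rho> i b)\<bar> \<le> \<Delta>" if "a < n" "b < n" "a \<noteq> b" for a b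
    using rank_count_near_third[OF \<rho> bal _ _ \<Delta>(1)] n(1) that by (intro sum_dev_abs_le[OF \<rho>]) auto
  \<comment> \<open>Otherwise \<open>4 * 2 ^ k \<le> n\<close>, and some disjoint pair would be
    separated by no order, contrary to \<open>pos\<close>.\<close>
  have "T \<le> k"
  proof (rule ccontr)
    assume "\<not> T \<le> k"
    have "4 \<le> sqrt (real n)" using n(1) by (intro real_le_rsqrt) auto
    have "(2::real) ^ k \<le> 2 ^ T" using \<open>\<not> T \<le> k\<close> by (intro power_increasing) auto
    also have "\<dots> \<le> 16 ^ T" by (intro power_mono) auto
    finally have "4 * (2::real) ^ k \<le> sqrt (real n) * sqrt (real n)"
      using T16 \<open>4 \<le> sqrt (real n)\<close> by (intro mult_mono) auto
    then have "real (4 * 2 ^ k) \<le> real n" by simp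
    then have "4 * 2 ^ k \<le> n" by (simp only: of_nat_le_iff)
    from exists_unseparated[OF \<rho> this] pos show False by fastforce
  qed
  obtain S where S: "S \<subseteq> {..<n}" "n \<le> card S * 16 ^ T"
    "\<forall>i<T. \<forall>a\<in>S. \<forall>b\<in>S. \<bar>real (\<rho> i a) - real (\<rho> i b)\<bar> \<le> real n / 10"
    using exists_cluster[OF n(1), of T \<rho>] \<rho> \<open>T \<le> k\<close> by auto
  have "S \<noteq> {}" using S(2) n(1) by auto
  have "real n \<le> real (card S) * 16 ^ T" using S(2) by (metis of_nat_le_iff of_nat_mult of_nat_numeral of_nat_power)
  also have "\<dots> \<le> real (card S) * sqrt (real n)" using T16 by (intro mult_left_mono) auto
  finally have "sqrt (real n) * sqrt (real n) \<le> real (card S) * sqrt (real n)" by simp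
  then have card: "sqrt (real n) \<le> real (card S)"
    using n(1) by (simp only: mult_le_cancel_right_pos real_sqrt_gt_0_iff of_nat_0_less_iff)
  have "real k \<le> 320000 * \<Delta>\<^sup>2"
    using family_size_le_square[OF \<rho> dev n(1) small] by blast
  also have "\<Delta>\<^sup>2 \<le> (l / 1000)\<^sup>2" using \<Delta> by (intro power_mono) (auto simp: l_def)
  \<comment> \<open>The constants fit because \<open>320000 / 1000^2 < 1\<close>. The loss
    \<open>3 * k\<close> is thereby absorbed into \<open>card S - 1\<close>.\<close>
  finally have "real k \<le> l\<^sup>2" by (simp add: power_divide)
  then have "3 * real k \<le> real (card S) - 1" using n(2) card by (simp add: l_def)
  moreover have "real T / 20 * (real (card S) - 1) \<le> \<Delta> * (real (card S) - 1) + 3 * real k"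
    using cluster_bound[OF \<rho> dev n(1) \<open>T \<le> k\<close> S(1) \<open>S \<noteq> {}\<close>] S(3) by blast
  ultimately have "real T / 20 * (real (card S) - 1) \<le> (\<Delta> + 1) * (real (card S) - 1)"
    by (simp add: algebra_simps)
  moreover have "real (card S) - 1 > 0"
  proof -
    have "1 < sqrt (real n)" using n(1) by simp
    then show ?thesis using card by linarith
  qed
  ultimately have "real T / 20 \<le> \<Delta> + 1" by simp
  \<comment> \<open>With \<open>l / 8 - 1 \<le> T\<close> and \<open>\<Delta> \<le> l / 1000\<close>
    this would force \<open>l \<le> 200\<close>.\<close>
  then show False using T(2) \<Delta>(2) n(3) by (simp add: l_def)
qed

text \<open>The restriction \<open>4 \<le> n\<close> excludes graphs without disjoint edges: there
  the empty family is separating, and the bound fails for \<open>n\<close> from \<open>1\<close> to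
  \<open>3\<close>.\<close>

theorem theorem3:
  shows "\<exists>c K :: real. c > 0 \<and> K > 0 \<and>
    (\<forall>n \<Delta> :: nat. 4 \<le> n \<longrightarrow> real \<Delta> \<le> c * log 2 (real n) \<longrightarrow>
      real (balanced_sep_dim \<Delta> (complete_graph n)) \<ge> real n / K)"
proof -
  obtain n0 where n0: "\<And>n. n0 \<le> n \<Longrightarrow>
      400 \<le> n \<and> 3 * (log 2 (real n))\<^sup>2 \<le> sqrt (real n) - 1 \<and> 300 \<le> log 2 (real n)"
    using eventually_log_bounds by (auto simp: eventually_sequentially)
  \<comment> \<open>From \<open>n0\<close> on the constant \<open>3200000\<close> suffices; below
    \<open>n0\<close> the bound \<open>n / K\<close> is less than \<open>1\<close>.\<close>
  define K where "K = real (max n0 3200000)"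
  have "real n / K \<le> real (balanced_sep_dim \<Delta> (complete_graph n))"
    if n: "4 \<le> n" and \<Delta>: "real \<Delta> \<le> 1 / 1000 * log 2 (real n)" for n \<Delta>
  proof -
    define k where "k = balanced_sep_dim \<Delta> (complete_graph n)"
    have "\<exists>k F. balanced_separating_family \<Delta> (complete_graph n) F \<and> size F = k"
      using balanced_separating_family_exists[OF finite_simple_graph_complete_graph] by blast
    then have "\<exists>F. balanced_separating_family \<Delta> (complete_graph n) F \<and> size F = k"
      unfolding k_def balanced_sep_dim_def by (rule LeastI_ex)
    then obtain F where F: "balanced_separating_family \<Delta> (complete_graph n) F" "size F = k" by blast
    obtain rs where rs: "F = mset rs" using ex_mset by metis
    have len: "length rs = k" using F(2) rs by simp
    have "\<exists>\<rho>. bij_betw \<rho> {..<n} {..<n} \<and> (\<forall>x<n. \<forall>y<n. (x, y) \<in> rs ! i \<longleftrightarrow> \<rho> x \<le> (\<rho> y :: nat))"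
      if "i < k" for i
    proof (rule linear_order_rank)
      show "linear_order_on {..<n} (rs ! i)"
        using F(1) that len
        by (auto simp: rs balanced_separating_family_def separating_family_def complete_graph_def)
    qed
    then obtain \<rho> where \<rho>: "\<And>i. i < k \<Longrightarrow> bij_betw (\<rho> i) {..<n} {..<n}"
      "\<And>i x y. i < k \<Longrightarrow> x < n \<Longrightarrow> y < n \<Longrightarrow> (x, y) \<in> rs ! i \<longleftrightarrow> \<rho> i x \<le> (\<rho> i y :: nat)"
      by metis
    have cnt: "sep_count F {a, b} {c, d} = rank_count k \<rho> a b c d"
      if "{a, b, c, d} \<subseteq> {..<n}" "distinct [a, b, c, d]" for a b c d
      using sep_count_eq_rank_count[of rs \<rho> n a b c d] \<rho> that by (simp add: len rs)
    have edge: "{a, b} \<in> edges (complete_graph n)" if "a < n" "b < n" "a \<noteq> b" for a b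
      using that by (simp add: complete_graph_def)
    have pos: "0 < rank_count k \<rho> a b c d"
      if abcd: "{a, b, c, d} \<subseteq> {..<n}" "distinct [a, b, c, d]" for a b c d
    proof -
      have "\<exists>r\<in>#F. separates r {a, b} {c, d}"
        using F(1) abcd edge[of a b] edge[of c d]
        by (auto simp: balanced_separating_family_def separating_family_def)
      then have "filter_mset (\<lambda>r. separates r {a, b} {c, d}) F \<noteq> {#}"
        by (auto simp: filter_mset_eq_conv)
      then show ?thesis
        unfolding cnt[OF abcd, symmetric] sep_count_def by (simp only: nonempty_has_size)
    qed
    have bal: "real (rank_count k \<rho> a b c d) \<le> real (rank_count k \<rho> a' b' c' d') + real \<Delta>"
      if "{a, b, c, d, a', b', c', d'} \<subseteq> {..<n}" "distinct [a, b, c, d]" "distinct [a', b', c', d']"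
      for a b c d a' b' c' d'
    proof -
      have "\<bar>int (sep_count F {a, b} {c, d}) - int (sep_count F {a', b'} {c', d'})\<bar> \<le> int \<Delta>"
        using F(1) that edge[of a b] edge[of c d] edge[of a' b'] edge[of c' d']
        unfolding balanced_separating_family_def by simp
      then show ?thesis using cnt[of a b c d] cnt[of a' b' c' d'] that by simp
    qed
    have "n < max n0 3200000 * k"
    proof (cases "n0 \<le> n")
      case True
      then have "n < 3200000 * k"
        using rank_family_size_ge[OF \<rho>(1) pos bal] n0[OF True] \<Delta> by auto
      also have "\<dots> \<le> max n0 3200000 * k" by (intro mult_le_mono1) auto
      finally show ?thesis .
    next
      case False
      \<comment> \<open>For small \<open>n\<close> a nonempty family is enough, and
        \<open>4 \<le> n\<close> supplies two disjoint edges that some order must separate.\<close>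
      have "0 < rank_count k \<rho> 0 1 2 3" using n by (intro pos) auto
      then have "k \<noteq> 0" by (cases "k = 0") (auto simp: rank_count_def)
      then have "1 \<le> k" by simp
      then have "max n0 3200000 * 1 \<le> max n0 3200000 * k" by (rule mult_le_mono2)
      moreover have "n < max n0 3200000 * 1" using False by simp
      ultimately show ?thesis by (rule less_le_trans[rotated])
    qed
    then have "real n \<le> K * real k"
      unfolding K_def by (metis less_imp_le of_nat_le_iff of_nat_mult)
    then show ?thesis
      unfolding k_def[symmetric] by (simp add: K_def divide_le_eq mult.commute)
  qed
  moreover have "0 < K" by (simp add: K_def)
  ultimately show ?thesis by (intro exI[of _ "1 / 1000"] exI[of _ K]) auto
qed

end
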